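(* Let $f:K_{3,3}\to\mathbb{R}^{2}$ be a plane generic immersion of the complete bipartite graph $K_{3,3}$. Then \[ \sum_{\gamma\in\Gamma_{4}(K_{3,3})}\mathrm{rot}(f(\gamma))\equiv 0\pmod 2 \qquad\text{and}\qquad \sum_{\gamma\in\Gamma_{6}(K_{3,3})}\mathrm{rot}(f(\gamma))\equiv 1\pmod 2, \] where $\Gamma_k(K_{3,3})$ is the set of all $k$-cycles of $K_{3,3}$.
   Context: A finite graph $G$ is regarded as a topological space in the usual way. A $k$-cycle of $G$ is a subgraph with $k$ edges homeomorphic to a circle. A plane generic immersion of $G$ is an immersion $f:G\to\mathbb{R}^2$ (a continuous locally injective, piecewise smooth map) whose multiple points are only finitely many transversal double points between edges, i.e. between interior points of edges (possibly of the same edge). Each cycle $\gamma$ is given an arbitrary orientation, and $\mathrm{rot}(f(\gamma))$ is the rotation number (turning number) of the oriented immersed closed plane curve $f(\gamma)$, corners at vertices being smoothed; equivalently, parametrizing $f|_\gamma$ by $c:\mathbb{R}/\mathbb{Z}\to\mathbb{R}^2$, it is the degree of $t\mapsto (c(t+\epsilon)-c(t))/\|c(t+\epsilon)-c(t)\|$ for small $\epsilon>0$. Its parity does not depend on the orientation. *)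

theory Defs
  imports
    "HOL-Complex_Analysis.Complex_Analysis"
    "HOL-Number_Theory.Cong"
begin

text \<open>
  A finite simple graph without isolated vertices, on a finite vertex type, is given by its set
  of edges, an edge being the set of its two end points.  Its topological space is the usual
  geometric realization: vertex \<open>v\<close> is the \<open>v\<close>-th standard basis vector, an edge is the segment
  joining its end points.  The plane is the type \<^typ>\<open>complex\<close>.
\<close>

definition vertex_point :: "'v::finite \<Rightarrow> real ^ 'v" where
  "vertex_point v = axis v 1"

definition realization :: "'v::finite set set \<Rightarrow> (real ^ 'v) set" where
  "realization E = (\<Union>e\<in>E. convex hull (vertex_point ` e))"

definition edge_path :: "'v::finite \<Rightarrow> 'v \<Rightarrow> real \<Rightarrow> real ^ 'v" where
  "edge_path u v = linepath (vertex_point u) (vertex_point v)"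

definition K33 :: "(3 + 3) set set" where
  "K33 = {{Inl i, Inr j} | i j. True}"

text \<open>A subgraph homeomorphic to a circle has no isolated vertices, so it is determined by its
  set of edges.\<close>

definition cycles :: "nat \<Rightarrow> 'v::finite set set \<Rightarrow> 'v set set set" where
  "cycles k E =
     {\<gamma>. \<gamma> \<subseteq> E \<and> card \<gamma> = k \<and> realization \<gamma> homeomorphic sphere (0::complex) 1}"

definition locally_injective_on ::
    "('a::topological_space \<Rightarrow> 'b) \<Rightarrow> 'a set \<Rightarrow> bool" where
  "locally_injective_on f S \<longleftrightarrow> (\<forall>x\<in>S. \<exists>U. open U \<and> x \<in> U \<and> inj_on f (U \<inter> S))"

text \<open>The two preimages are interior points of (possibly equal) edges, and the two branches have
  velocity vectors there that span the plane.\<close>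

definition transversal_double_point ::
    "'v::finite set set \<Rightarrow> (real ^ 'v \<Rightarrow> complex) \<Rightarrow> complex \<Rightarrow> bool" where
  "transversal_double_point E f y \<longleftrightarrow>
     (\<exists>u v s u' v' s' d d'.
        {u, v} \<in> E \<and> {u', v'} \<in> E \<and> s \<in> {0<..<1} \<and> s' \<in> {0<..<1} \<and>
        edge_path u v s \<noteq> edge_path u' v' s' \<and>
        {x \<in> realization E. f x = y} = {edge_path u v s, edge_path u' v' s'} \<and>
        ((f \<circ> edge_path u v) has_vector_derivative d) (at s) \<and>
        ((f \<circ> edge_path u' v') has_vector_derivative d') (at s') \<and>
        span {d, d'} = UNIV)"

definition multiple_points ::
    "'v::finite set set \<Rightarrow> (real ^ 'v \<Rightarrow> complex) \<Rightarrow> complex set" where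
  "multiple_points E f =
     {y. \<exists>x\<in>realization E. \<exists>x'\<in>realization E. x \<noteq> x' \<and> f x = y \<and> f x' = y}"

definition plane_generic_immersion ::
    "'v::finite set set \<Rightarrow> (real ^ 'v \<Rightarrow> complex) \<Rightarrow> bool" where
  "plane_generic_immersion E f \<longleftrightarrow>
     continuous_on (realization E) f \<and>
     locally_injective_on f (realization E) \<and>
     (\<forall>u v. {u, v} \<in> E \<longrightarrow> (f \<circ> edge_path u v) piecewise_C1_differentiable_on {0..1}) \<and>
     finite (multiple_points E f) \<and>
     (\<forall>y\<in>multiple_points E f. transversal_double_point E f y)"

text \<open>A parametrization of a cycle by \<open>[0,1]\<close> with \<open>0\<close> and \<open>1\<close> identified; its direction is the
  orientation of the cycle.\<close>

definition cycle_parametrization ::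
    "'v::finite set set \<Rightarrow> (real \<Rightarrow> real ^ 'v) \<Rightarrow> bool" where
  "cycle_parametrization \<gamma> p \<longleftrightarrow>
     simple_path p \<and> pathfinish p = pathstart p \<and> path_image p = realization \<gamma>"

text \<open>
  For a closed curve \<open>c\<close>, \<open>shiftpath \<epsilon> c t\<close> is \<open>c (t + \<epsilon>)\<close> with \<open>t + \<epsilon>\<close> taken modulo \<open>1\<close>.  The
  degree of a closed curve in the unit circle is its winding number about \<open>0\<close>, so this is the
  degree of \<open>(c (t + \<epsilon>) - c t) / norm (c (t + \<epsilon>) - c t)\<close> for all small \<open>\<epsilon> > 0\<close>.
\<close>

definition rotation_number :: "(real \<Rightarrow> complex) \<Rightarrow> int" where
  "rotation_number c =
     (THE n. \<forall>\<^sub>F \<epsilon> in at_right 0.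
        winding_number (\<lambda>t. sgn (shiftpath \<epsilon> c t - c t)) 0 = of_int n)"

end

theory Submission
  imports Defs
begin

text \<open>
  Fix a small \<open>\<delta>\<close> and follow the chord from \<open>f (x t)\<close> to \<open>f (x (t + \<delta>))\<close> around a cycle.  The rotation
  number is the total turning of this chord, a sum of contributions of the edges (both chord ends
  on one edge) and of the corners (the chord passes a vertex).  Let \<open>A u v\<close> be a logarithm, in units of
  \<open>2 \<pi> \<i>\<close>, of the chord leaving \<open>u\<close> towards \<open>v\<close>.  The edge from \<open>u\<close> to \<open>v\<close> contributes
  \<open>A v u + 1/2 - A u v + n u v\<close> and the corner from \<open>u\<close> through \<open>v\<close> to \<open>w\<close> contributes
  \<open>A v w - A v u - 1/2 + m u v w\<close> for integers \<open>n\<close>, \<open>m\<close>; around a cycle everything but \<open>n\<close> and \<open>m\<close> cancels.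
  Reversing the direction negates the contributions, so \<open>n v u = - 1 - n u v\<close> and
  \<open>m w v u = 1 - m u v w\<close>.  In \<open>K\<^sub>3\<^sub>,\<^sub>3\<close> every edge lies on four 4-cycles and on four 6-cycles and every
  corner on two of each, hence modulo 2 the sum does not depend on \<open>n\<close> and \<open>m\<close>: it is the number of
  corners that are traversed in both directions plus the number of traversals of edges against
  a fixed direction.  Double points play no role.
\<close>

section \<open>Rotation numbers via logarithms of chords\<close>

lemma eq_exp_add_Ints:
  assumes "exp (2 * of_real pi * \<i> * x) = exp (2 * of_real pi * \<i> * y)"
  shows "\<exists>n::int. x = y + of_int n"
proof -
  obtain n :: int where "2 * of_real pi * \<i> * x = 2 * of_real pi * \<i> * y + (of_int (2 * n) * pi) * \<i>"
    using assms by (auto simp: exp_eq)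
  then have "(2 * of_real pi * \<i>) * x = (2 * of_real pi * \<i>) * (y + of_int n)"
    by (simp add: algebra_simps)
  then show ?thesis
    by (metis mult_cancel_left complex_i_not_zero mult_eq_0_iff of_real_eq_0_iff pi_neq_zero zero_neq_numeral)
qed

lemma winding_number_eq_log_difference:
  assumes "continuous_on {0..1} \<theta>" "\<And>t. t \<in> {0..1} \<Longrightarrow> g t = exp (\<theta> t)"
  shows "winding_number g 0 = (\<theta> 1 - \<theta> 0) / (2 * of_real pi * \<i>)"
proof -
  have "winding_number g 0 = winding_number (exp \<circ> \<theta>) 0"
    using assms(2) by (intro winding_number_cong) auto
  with winding_number_compose_exp[of \<theta>] assms(1) show ?thesis
    by (simp add: path_def pathstart_def pathfinish_def)
qed

text \<open>Normalizing \<open>exp z\<close> keeps only the imaginary part of \<open>z\<close>. The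
  total change of \<open>\<theta>\<close> is purely imaginary by \<open>n\<close>, so passing to
  \<open>sgn\<close> loses nothing.\<close>

lemma winding_number_sgn_eq_log_difference:
  assumes \<theta>: "continuous_on {0..1} \<theta>" "\<And>t. t \<in> {0..1} \<Longrightarrow> g t = exp (\<theta> t)"
    and n: "\<theta> 1 - \<theta> 0 = 2 * of_real pi * \<i> * of_int n"
  shows "winding_number (\<lambda>t. sgn (g t)) 0 = of_int n"
proof -
  have "sgn (exp z) = exp (\<i> * Im z)" for z
  proof -
    have "exp z = of_real (exp (Re z)) * exp (\<i> * Im z)"
      by (metis complex_eq exp_add exp_of_real)
    then show ?thesis
      by (simp add: sgn_div_norm norm_mult scaleR_conv_of_real)
  qed
  then have "winding_number (\<lambda>t. sgn (g t)) 0
      = (\<i> * Im (\<theta> 1) - \<i> * Im (\<theta> 0)) / (2 * of_real pi * \<i>)"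
    using \<theta> by (intro winding_number_eq_log_difference continuous_intros) auto
  also have "\<dots> = \<i> * Im (\<theta> 1 - \<theta> 0) / (2 * of_real pi * \<i>)"
    by (simp add: algebra_simps)
  also have "\<dots> = of_int n"
    by (simp add: n)
  finally show ?thesis .
qed

text \<open>The pairs of a base point and a chord length in \<open>{0<..\<delta>}\<close> form a
  convex set on which the chord never vanishes, so one logarithm serves chords of all these lengths
  at once. Its change over a period is an integer number of turns depending continuously on the
  pair, hence a constant \<open>r\<close>.\<close>

lemma chord_logarithm:
  fixes c :: "real \<Rightarrow> complex"
  assumes c: "continuous_on UNIV c" "\<And>t. c (t + k) = c t"
    and inj: "\<And>t u. 0 < u \<Longrightarrow> u \<le> \<delta> \<Longrightarrow> c (t + u) \<noteq> c t"
    and "0 < \<delta>"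
  obtains \<Theta> r where "continuous_on (UNIV \<times> {0<..\<delta>}) \<Theta>"
    and "\<And>y u. 0 < u \<Longrightarrow> u \<le> \<delta> \<Longrightarrow> c (y + u) - c y = exp (\<Theta> (y, u))"
    and "\<And>y u. 0 < u \<Longrightarrow> u \<le> \<delta> \<Longrightarrow> \<Theta> (y + k, u) - \<Theta> (y, u) = 2 * of_real pi * \<i> * of_int r"
proof -
  let ?S = "UNIV \<times> {0<..\<delta>} :: (real \<times> real) set"
  have convex: "convex ?S"
    by (intro convex_Times) auto
  have "continuous_on ?S (\<lambda>x. c (fst x + snd x) - c (fst x))"
    by (intro continuous_intros continuous_on_compose2[OF c(1)]) auto
  then obtain \<Theta> where \<Theta>: "continuous_on ?S \<Theta>"
      "\<And>x. x \<in> ?S \<Longrightarrow> c (fst x + snd x) - c (fst x) = exp (\<Theta> x)"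
    by (rule continuous_logarithm_on_contractible[OF _ convex_imp_contractible[OF convex]])
      (use inj in auto)
  \<comment> \<open>The change of the logarithm over one period, counted in full turns.\<close>
  define R where "R x = (\<Theta> (fst x + k, snd x) - \<Theta> x) / (2 * of_real pi * \<i>)" for x
  have R_int: "\<exists>n::int. R x = of_int n" if "x \<in> ?S" for x
  proof -
    have "exp (\<Theta> (fst x + k, snd x)) = exp (\<Theta> x)"
      using that \<Theta>(2)[of x] \<Theta>(2)[of "(fst x + k, snd x)"] c(2)[of "fst x"] c(2)[of "fst x + snd x"]
      by (auto simp: algebra_simps)
    then have "\<exists>n::int. \<Theta> (fst x + k, snd x) / (2 * of_real pi * \<i>)
                      = \<Theta> x / (2 * of_real pi * \<i>) + of_int n"
      by (intro eq_exp_add_Ints) simp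
    then show ?thesis
      by (auto simp: R_def diff_divide_distrib)
  qed
  have "R constant_on ?S"
  proof (rule continuous_discrete_range_constant)
    show "connected ?S"
      using convex by (rule convex_connected)
    show "continuous_on ?S R"
      unfolding R_def by (intro continuous_intros continuous_on_compose2[OF \<Theta>(1)]) auto
    fix x assume "x \<in> ?S"
    show "\<exists>e>0. \<forall>y. y \<in> ?S \<and> R y \<noteq> R x \<longrightarrow> e \<le> cmod (R y - R x)"
    proof (intro exI[of _ 1] conjI allI impI)
      fix y assume y: "y \<in> ?S \<and> R y \<noteq> R x"
      obtain m n :: int where mn: "R y = of_int m" "R x = of_int n"
        using R_int[of x] R_int[of y] y \<open>x \<in> ?S\<close> by blast
      with y have "1 \<le> \<bar>m - n\<bar>"
        by auto
      moreover have "cmod (R y - R x) = \<bar>of_int (m - n)\<bar>"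
        unfolding mn by (metis norm_of_int of_int_diff)
      ultimately show "1 \<le> cmod (R y - R x)"
        by linarith
    qed auto
  qed
  then obtain z where z: "\<And>x. x \<in> ?S \<Longrightarrow> R x = z"
    by (auto simp: constant_on_def)
  obtain r :: int where "z = of_int r"
    using R_int[of "(0, \<delta>)"] z[of "(0, \<delta>)"] \<open>0 < \<delta>\<close> by auto
  with z have "\<Theta> (y + k, u) - \<Theta> (y, u) = 2 * of_real pi * \<i> * of_int r" if "0 < u" "u \<le> \<delta>" for y u
    using z[of "(y, u)"] that by (auto simp: R_def field_simps)
  with \<Theta> that show thesis
    by (metis (no_types, lifting) SigmaI UNIV_I fst_conv greaterThanAtMost_iff snd_conv)
qed

lemma rotation_number_eqI:
  assumes "\<forall>\<^sub>F \<epsilon> in at_right 0. winding_number (\<lambda>t. sgn (shiftpath \<epsilon> c t - c t)) 0 = of_int n"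
  shows "rotation_number c = n"
  unfolding rotation_number_def
proof (rule the_equality)
  show "\<forall>\<^sub>F \<epsilon> in at_right 0. winding_number (\<lambda>t. sgn (shiftpath \<epsilon> c t - c t)) 0 = of_int n"
    by (fact assms)
next
  fix m :: int
  assume "\<forall>\<^sub>F \<epsilon> in at_right 0. winding_number (\<lambda>t. sgn (shiftpath \<epsilon> c t - c t)) 0 = of_int m"
  with assms have "\<forall>\<^sub>F \<epsilon> in at_right (0::real). m = n"
    by eventually_elim (metis of_int_eq_iff)
  then show "m = n"
    by (simp add: eventually_const_iff trivial_limit_at_right_real)
qed

text \<open>Shifting the parameter of \<open>C\<close> by \<open>\<epsilon>\<close> moves along
  \<open>c\<close> by a varying amount, which is why \<open>\<Theta>\<close> covers all lengths up
  to \<open>\<delta>\<close> and not a single one. The sign \<open>\<sigma>\<close> records whether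
  \<open>h\<close> runs with or against \<open>c\<close>.\<close>

lemma rotation_number_reparametrized:
  fixes c C :: "real \<Rightarrow> complex"
  assumes c: "\<And>t. c (t + k) = c t"
    and \<Theta>: "continuous_on (UNIV \<times> {0<..\<delta>}) \<Theta>"
       "\<And>y u. 0 < u \<Longrightarrow> u \<le> \<delta> \<Longrightarrow> c (y + u) - c y = exp (\<Theta> (y, u))"
       "\<And>y u. 0 < u \<Longrightarrow> u \<le> \<delta> \<Longrightarrow> \<Theta> (y + k, u) - \<Theta> (y, u) = 2 * of_real pi * \<i> * of_int r"
    and "0 < \<delta>"
    and C: "\<And>t. t \<in> {0..1} \<Longrightarrow> C t = c (h t)"
    and h: "continuous_on {0..1} h"
    and dir: "strict_mono_on {0..1} h \<and> h 1 = h 0 + k \<and> \<sigma> = 1 \<or>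
         strict_antimono_on {0..1} h \<and> h 1 = h 0 - k \<and> \<sigma> = - 1"
  shows "rotation_number C = \<sigma> * r"
proof (rule rotation_number_eqI)
  \<comment> \<open>Continues \<open>h\<close> beyond 1 by its own increment
    \<open>\<sigma> * k\<close>, so that the wrap-around in \<open>shiftpath\<close> turns into the
    periodicity of \<open>c\<close>.\<close>
  define H where "H t = (if t \<le> 1 then h t else h (t - 1) + \<sigma> * k)" for t
  have contH: "continuous_on {0..2} H"
  proof -
    have "continuous_on ({0..1} \<union> {1..2}) (\<lambda>t. if t \<le> 1 then h t else h (t - 1) + \<sigma> * k)"
    proof (rule continuous_on_cases)
      show "continuous_on {1..2} (\<lambda>t. h (t - 1) + \<sigma> * k)"
        by (intro continuous_intros continuous_on_compose2[OF h]) auto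
    qed (use h dir in auto)
    then show ?thesis
      by (simp add: H_def ivl_disj_un)
  qed
  then have "uniformly_continuous_on {0..2} H"
    by (intro compact_uniformly_continuous) auto
  \<comment> \<open>For \<open>\<epsilon>\<close> below \<open>d\<close> every chord produced by the
    shift has length below \<open>\<delta>\<close> in the parameter of \<open>c\<close>.\<close>
  then obtain d where d: "d > 0"
      "\<And>s t. s \<in> {0..2} \<Longrightarrow> t \<in> {0..2} \<Longrightarrow> \<bar>s - t\<bar> < d \<Longrightarrow> \<bar>H s - H t\<bar> < \<delta>"
    unfolding uniformly_continuous_on_def dist_real_def using \<open>0 < \<delta>\<close> by metis
  have H0: "H (t + 1) = H t + \<sigma> * k" if "t \<in> {0..1}" for t
    using that dir by (auto simp: H_def)
  have step_h: "\<sigma> * (h t - h s) > 0" if "s \<in> {0..1}" "t \<in> {0..1}" "s < t" for s t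
    using dir that monotone_onD[of "{0..1}" "(<)" "(<)" h s t] monotone_onD[of "{0..1}" "(<)" "(>)" h s t]
    by (elim disjE) simp_all
  have step: "\<sigma> * (H t - H s) > 0" if "s \<in> {0..1}" "s < t" "t < s + 1" for s t
  proof (cases "t \<le> 1")
    case True
    with that step_h[of s t] show ?thesis
      by (simp add: H_def)
  next
    case False
    have "\<sigma> * (h 1 - h s) \<ge> 0"
      using that step_h[of s 1] by (cases "s = 1") simp_all
    moreover have "\<sigma> * (h (t - 1) - h 0) > 0"
      using that False step_h[of 0 "t - 1"] by simp
    ultimately have "\<sigma> * (h (t - 1) + (h 1 - h 0) - h s) > 0"
      by (simp add: algebra_simps)
    moreover have "h 1 - h 0 = \<sigma> * k"
      using dir by auto
    ultimately show ?thesis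
      using False that by (simp add: H_def)
  qed
  have "\<forall>\<^sub>F \<epsilon> in at_right 0. \<epsilon> \<in> {0<..<min d 1}"
    using d(1) by (intro eventually_at_right_real) simp
  then show "\<forall>\<^sub>F \<epsilon> in at_right 0. winding_number (\<lambda>t. sgn (shiftpath \<epsilon> C t - C t)) 0 = of_int (\<sigma> * r)"
  proof eventually_elim
    case (elim \<epsilon>)
    have shift: "shiftpath \<epsilon> C t - C t = c (H (t + \<epsilon>)) - c (H t)" if "t \<in> {0..1}" for t
    proof -
      have "c (s + \<sigma> * k) = c s" for s
        using dir c[of s] c[of "s - k"] by (elim disjE) simp_all
      then show ?thesis
        using that elim C[of t] C[of "t + \<epsilon>"] C[of "t + \<epsilon> - 1"]
        by (simp add: shiftpath_def H_def add.commute[of \<epsilon> t])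
    qed
    have close: "\<bar>H (t + \<epsilon>) - H t\<bar> < \<delta>" if "t \<in> {0..1}" for t
      using that elim d(2)[of "t + \<epsilon>" t] by simp
    have pos: "\<sigma> * (H (t + \<epsilon>) - H t) > 0" if "t \<in> {0..1}" for t
      using that elim step[of t "t + \<epsilon>"] by simp
    have cont0: "continuous_on {0..1} H"
      by (rule continuous_on_subset[OF contH]) simp
    have cont1: "continuous_on {0..1} (\<lambda>t. H (t + \<epsilon>))"
      by (rule continuous_on_compose2[OF contH]) (use elim in \<open>auto intro!: continuous_intros\<close>)
    have H1: "H 1 = H 0 + \<sigma> * k" "H (1 + \<epsilon>) = H \<epsilon> + \<sigma> * k"
      using H0[of 0] H0[of \<epsilon>] elim by (simp_all add: add.commute)
    from dir consider "\<sigma> = 1" | "\<sigma> = - 1" by blast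
    then show ?case
    proof cases
      case 1
      have bound: "0 < H (t + \<epsilon>) - H t" "H (t + \<epsilon>) - H t \<le> \<delta>" if "t \<in> {0..1}" for t
        using close[OF that] pos[OF that] 1 by simp_all
      show ?thesis
      proof (rule winding_number_sgn_eq_log_difference)
        show "continuous_on {0..1} (\<lambda>t. \<Theta> (H t, H (t + \<epsilon>) - H t))"
          by (rule continuous_on_compose2[OF \<Theta>(1)]) (use bound in \<open>auto intro!: continuous_intros cont0 cont1\<close>)
        show "shiftpath \<epsilon> C t - C t = exp (\<Theta> (H t, H (t + \<epsilon>) - H t))" if "t \<in> {0..1}" for t
          using shift[OF that] \<Theta>(2)[OF bound[OF that], of "H t"] by simp
        show "\<Theta> (H 1, H (1 + \<epsilon>) - H 1) - \<Theta> (H 0, H (0 + \<epsilon>) - H 0) =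
            2 * of_real pi * \<i> * of_int (\<sigma> * r)"
          using \<Theta>(3)[OF bound[of 0], of "H 0"] 1 by (simp add: H1)
      qed
    next
      case 2
      \<comment> \<open>The shifted point now lies behind, so the chord is minus the chord of
        \<open>c\<close> based at \<open>H (t + \<epsilon>)\<close>; the sign becomes the summand
        \<open>\<i> * of_real pi\<close>.\<close>
      have bound: "0 < H t - H (t + \<epsilon>)" "H t - H (t + \<epsilon>) \<le> \<delta>" if "t \<in> {0..1}" for t
        using close[OF that] pos[OF that] 2 by simp_all
      show ?thesis
      proof (rule winding_number_sgn_eq_log_difference)
        show "continuous_on {0..1} (\<lambda>t. \<Theta> (H (t + \<epsilon>), H t - H (t + \<epsilon>)) + \<i> * of_real pi)"
          by (intro continuous_on_add continuous_on_const continuous_on_compose2[OF \<Theta>(1)])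
            (use bound in \<open>auto intro!: continuous_intros cont0 cont1\<close>)
        show "shiftpath \<epsilon> C t - C t = exp (\<Theta> (H (t + \<epsilon>), H t - H (t + \<epsilon>)) + \<i> * of_real pi)"
          if "t \<in> {0..1}" for t
          using shift[OF that] \<Theta>(2)[OF bound[OF that], of "H (t + \<epsilon>)"]
          by (simp add: exp_add algebra_simps)
        show "\<Theta> (H (1 + \<epsilon>), H 1 - H (1 + \<epsilon>)) + \<i> * of_real pi -
              (\<Theta> (H (0 + \<epsilon>), H 0 - H (0 + \<epsilon>)) + \<i> * of_real pi) =
            2 * of_real pi * \<i> * of_int (\<sigma> * r)"
          \<comment> \<open>One period of \<open>c\<close> starting at the final base point
            \<open>H \<epsilon> - k\<close>, read backwards, produces \<open>- r\<close>.\<close>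
          using \<Theta>(3)[OF bound[of 0], of "H \<epsilon> - k"] 2 by (simp add: H1 algebra_simps)
      qed
    qed
  qed
qed

section \<open>Walks in a geometric realization\<close>

lemma edge_path_component:
  "edge_path u v s $ w = (1 - s) * (if w = u then 1 else 0) + s * (if w = v then 1 else 0)"
  by (simp add: edge_path_def vertex_point_def linepath_def axis_def)

lemma edge_path_reverse: "edge_path u v (1 - s) = edge_path v u s"
  by (simp add: edge_path_def linepath_def add.commute)

lemma edge_path_ends [simp]: "edge_path u v 0 = vertex_point u" "edge_path u v 1 = vertex_point v"
  by (simp_all add: edge_path_def linepath_def)

lemma norm_edge_path_diff_le: "norm (edge_path u v s - edge_path u v t) \<le> 2 * \<bar>s - t\<bar>"
proof -
  have "edge_path u v s - edge_path u v t = (s - t) *\<^sub>R (vertex_point v - vertex_point u)"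
    by (simp add: edge_path_def linepath_def algebra_simps)
  moreover have "norm (vertex_point v - vertex_point u) \<le> 2"
    using norm_triangle_ineq4[of "vertex_point v" "vertex_point u"] by (simp add: vertex_point_def)
  ultimately show ?thesis
    using mult_left_mono[of "norm (vertex_point v - vertex_point u)" 2 "\<bar>s - t\<bar>"] by simp
qed

lemma continuous_on_edge_path [continuous_intros]:
  "continuous_on S g \<Longrightarrow> continuous_on S (\<lambda>x. edge_path u v (g x))"
  unfolding edge_path_def linepath_def by (intro continuous_intros)

lemma convex_hull_edge:
  "convex hull (vertex_point ` {u, v}) = edge_path u v ` {0..1}"
  using path_image_linepath[of "vertex_point u" "vertex_point v"]
  by (simp add: edge_path_def path_image_def segment_convex_hull)

text \<open>Defined on the whole line and for integer indices, so that a chord may run past the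
  start of the cycle without a case distinction.\<close>

definition polygon :: "(int \<Rightarrow> 'v::finite) \<Rightarrow> real \<Rightarrow> real ^ 'v" where
  "polygon v t = edge_path (v \<lfloor>t\<rfloor>) (v (\<lfloor>t\<rfloor> + 1)) (frac t)"

text \<open>The bound 3 makes three consecutive vertices distinct, so no edge is retraced.\<close>

definition cyclic_walk :: "int \<Rightarrow> (int \<Rightarrow> 'v) \<Rightarrow> bool" where
  "cyclic_walk k v \<longleftrightarrow> 3 \<le> k \<and> (\<forall>i j. v i = v j \<longleftrightarrow> [i = j] (mod k))"

definition walk_edges :: "int \<Rightarrow> (int \<Rightarrow> 'v) \<Rightarrow> 'v set set" where
  "walk_edges k v = (\<lambda>i. {v i, v (i + 1)}) ` {0..<k}"

text \<open>Both ends are included: an integer parameter can be read as the end of one edge or as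
  the start of the next.\<close>

lemma polygon_eq:
  assumes "of_int i \<le> t" "t \<le> of_int i + 1"
  shows "polygon v t = edge_path (v i) (v (i + 1)) (t - of_int i)"
proof (cases "t = of_int i + 1")
  case True
  then have "\<lfloor>t\<rfloor> = i + 1" by linarith
  then show ?thesis
    using True by (simp add: polygon_def frac_def)
next
  case False
  then have "\<lfloor>t\<rfloor> = i"
    using assms by linarith
  then show ?thesis
    by (simp add: polygon_def frac_def)
qed

lemma norm_polygon_diff_le:
  assumes "\<bar>s - t\<bar> \<le> 1"
  shows "norm (polygon v s - polygon v t) \<le> 2 * \<bar>s - t\<bar>"
proof -
  have main: "norm (polygon v s - polygon v t) \<le> 2 * (t - s)" if "s \<le> t" "t \<le> s + 1" for s t
  proof -
    have same: "norm (polygon v s - polygon v t) \<le> 2 * (t - s)"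
      if "s \<le> t" "of_int i \<le> s" "t \<le> of_int i + 1" for i s t
      using that norm_edge_path_diff_le[of "v i" "v (i + 1)" "s - of_int i" "t - of_int i"]
      by (simp add: polygon_eq[of i])
    show ?thesis
    proof (cases "t \<le> of_int \<lfloor>s\<rfloor> + 1")
      case True
      then show ?thesis
        using that by (intro same[of s t "\<lfloor>s\<rfloor>"]) auto
    next
      case False
      \<comment> \<open>The vertex between \<open>s\<close> and \<open>t\<close>; since these are at
        most 1 apart, there is no other.\<close>
      define m where "m = of_int \<lfloor>s\<rfloor> + (1::real)"
      have m: "s \<le> m" "m \<le> t" "t \<le> of_int (\<lfloor>s\<rfloor> + 1) + 1"
        using False that by (auto simp: m_def) linarith+
      have "norm (polygon v s - polygon v m) \<le> 2 * (m - s)"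
        using m by (intro same[of s m "\<lfloor>s\<rfloor>"]) (auto simp: m_def)
      moreover have "norm (polygon v m - polygon v t) \<le> 2 * (t - m)"
        using m by (intro same[of m t "\<lfloor>s\<rfloor> + 1"]) (auto simp: m_def)
      ultimately show ?thesis
        using norm_triangle_ineq[of "polygon v s - polygon v m" "polygon v m - polygon v t"] by simp
    qed
  qed
  show ?thesis
    using assms main[of s t] main[of t s] by (auto simp: norm_minus_commute abs_if split: if_splits)
qed

lemma continuous_on_polygon: "continuous_on S (polygon v)"
  unfolding continuous_on_iff
proof (intro ballI allI impI)
  fix x e :: real assume "0 < e"
  show "\<exists>d>0. \<forall>y\<in>S. dist y x < d \<longrightarrow> dist (polygon v y) (polygon v x) < e"
  proof (intro exI[of _ "min 1 (e / 2)"] conjI ballI impI)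
    fix y assume "dist y x < min 1 (e / 2)"
    then show "dist (polygon v y) (polygon v x) < e"
      using norm_polygon_diff_le[of y x v] by (auto simp: dist_norm)
  qed (use \<open>0 < e\<close> in auto)
qed

lemma polygon_periodic:
  assumes "\<And>i. v (i + k) = v i"
  shows "polygon v (t + of_int k) = polygon v t"
  using assms[of "\<lfloor>t\<rfloor>"] assms[of "\<lfloor>t\<rfloor> + 1"] by (simp add: polygon_def add_ac frac_def)

lemma cyclic_walk_periodic: "cyclic_walk k v \<Longrightarrow> v (i + k) = v i"
  by (simp add: cyclic_walk_def cong_def)

lemma cyclic_walk_Suc_neq:
  assumes "cyclic_walk k v" shows "v i \<noteq> v (i + 1)" "v i \<noteq> v (i + 2)"
proof -
  have "\<not> k dvd 1" "\<not> k dvd 2"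
    using assms zdvd_not_zless[of 1 k] zdvd_not_zless[of 2 k] by (auto simp: cyclic_walk_def)
  moreover have "[i = i + m] (mod k) \<longleftrightarrow> k dvd m" for m
    by (metis add.right_neutral cong_0_iff cong_add_lcancel cong_sym_eq)
  ultimately show "v i \<noteq> v (i + 1)" "v i \<noteq> v (i + 2)"
    using assms by (auto simp: cyclic_walk_def)
qed

text \<open>A point determines its edge through its nonzero coordinates. The other candidate, the
  same edge run backwards, would give \<open>v j = v (j + 2)\<close>, which a period of at least 3
  excludes.\<close>

lemma polygon_inj:
  assumes v: "cyclic_walk k v" and eq: "polygon v s = polygon v t"
  shows "\<exists>m::int. s = t + of_int (m * k)"
proof -
  let ?i = "\<lfloor>s\<rfloor>" and ?j = "\<lfloor>t\<rfloor>"
  have comp: "polygon v s $ w = polygon v t $ w" for w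
    using eq by simp
  have bounds: "0 \<le> frac s" "frac s < 1" "0 \<le> frac t" "frac t < 1"
    by (simp_all add: frac_lt_1)
  note neq = cyclic_walk_Suc_neq[OF v]
  have "v ?i = v ?j \<and> frac s = frac t"
  proof (cases "v ?i = v ?j")
    case True
    then show ?thesis
      using comp[of "v ?j"] neq(1)[of ?i] neq(1)[of ?j] by (simp add: polygon_def edge_path_component)
  next
    case False
    have 1: "v ?i = v (?j + 1)"
      using comp[of "v ?i"] neq(1)[of ?i] bounds False by (auto simp: polygon_def edge_path_component split: if_splits)
    have 2: "v ?j = v (?i + 1)"
      using comp[of "v ?j"] neq(1)[of ?j] bounds False by (auto simp: polygon_def edge_path_component split: if_splits)
    have "[?i + 1 = ?j + 2] (mod k)"
      using 1 v cong_add_rcancel[of ?i 1 "?j + 1" k] by (simp add: cyclic_walk_def add.assoc)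
    then have "v (?i + 1) = v (?j + 2)"
      using v by (simp add: cyclic_walk_def)
    then show ?thesis
      using 2 neq(2)[of ?j] by simp
  qed
  moreover obtain m where "?i = ?j + m * k"
    using calculation v by (metis cyclic_walk_def cong_iff_lin cong_sym mult.commute)
  ultimately have "s = t + of_int (m * k)"
    by (simp add: frac_def)
  then show ?thesis ..
qed

lemma realization_walk_edges:
  assumes v: "cyclic_walk k v"
  shows "realization (walk_edges k v) = polygon v ` {0..of_int k}"
    and "realization (walk_edges k v) = range (polygon v)"
proof -
  have k: "k \<ge> 3" using v by (simp add: cyclic_walk_def)
  have eq: "realization (walk_edges k v) = (\<Union>i\<in>{0..<k}. edge_path (v i) (v (i + 1)) ` {0..1})"
    unfolding realization_def walk_edges_def image_image
    by (rule SUP_cong[OF refl]) (rule convex_hull_edge)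
  have sub1: "realization (walk_edges k v) \<subseteq> polygon v ` {0..of_int k}"
  proof
    fix x assume "x \<in> realization (walk_edges k v)"
    then obtain i s where ist: "i \<in> {0..<k}" "s \<in> {0..1}" "x = edge_path (v i) (v (i + 1)) s"
      using eq by auto
    then have "x = polygon v (of_int i + s)"
      by (simp add: polygon_eq[of i])
    moreover have "of_int i + s \<in> {0..of_int k}"
    proof -
      have "of_int (i + 1) \<le> (of_int k :: real)"
        using ist by (subst of_int_le_iff) auto
      then show ?thesis
        using ist by auto
    qed
    ultimately show "x \<in> polygon v ` {0..of_int k}"
      by blast
  qed
  have sub2: "range (polygon v) \<subseteq> realization (walk_edges k v)"
  proof clarify
    fix t :: real
    define i where "i = \<lfloor>t\<rfloor> mod k"
    have "v i = v \<lfloor>t\<rfloor>" "v (i + 1) = v (\<lfloor>t\<rfloor> + 1)"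
      using v by (simp_all add: cyclic_walk_def i_def cong_def mod_simps)
    then have "polygon v t = edge_path (v i) (v (i + 1)) (frac t)"
      by (simp add: polygon_def)
    moreover have "i \<in> {0..<k}" "frac t \<in> {0..1}"
      using k by (auto simp: i_def less_imp_le frac_lt_1)
    ultimately show "polygon v t \<in> realization (walk_edges k v)"
      unfolding eq by blast
  qed
  show "realization (walk_edges k v) = polygon v ` {0..of_int k}"
    and "realization (walk_edges k v) = range (polygon v)"
    using sub1 sub2 by blast+
qed

lemma realization_walk_homeomorphic_circle:
  assumes v: "cyclic_walk k v"
  shows "realization (walk_edges k v) homeomorphic sphere (0::complex) 1"
proof -
  have k: "k \<ge> 3" using v by (simp add: cyclic_walk_def)
  let ?q = "\<lambda>t. polygon v (of_int k * t)"
  have "simple_path ?q"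
    unfolding simple_path_def loop_free_def path_def
  proof (intro conjI ballI impI)
    show "continuous_on {0..1} ?q"
      by (intro continuous_on_compose2[OF continuous_on_polygon[of UNIV]] continuous_intros) auto
    fix s t :: real
    assume st: "s \<in> {0..1}" "t \<in> {0..1}" "?q s = ?q t"
    obtain m :: int where "of_int k * s = of_int k * t + of_int (m * k)"
      using polygon_inj[OF v st(3)] by blast
    then have "of_int k * s = of_int k * (t + of_int m)"
      by (simp add: algebra_simps)
    then have m: "s = t + of_int m"
      using k by simp
    then have "of_int \<bar>m\<bar> \<le> (1::real)"
      using st(1,2) by auto
    then have "m \<in> {-1, 0, 1}"
      by auto
    with m st(1,2) show "s = t \<or> s = 0 \<and> t = 1 \<or> s = 1 \<and> t = 0"
      by auto
  qed
  moreover have "pathfinish ?q = pathstart ?q"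
    using polygon_periodic[of v k 0] cyclic_walk_periodic[OF v] by (simp add: pathfinish_def pathstart_def)
  moreover have "path_image ?q = realization (walk_edges k v)"
  proof -
    have "(\<lambda>t. of_int k * t) ` {0..1} = {0..real_of_int k}"
      using k image_mult_atLeastAtMost[of "real_of_int k" 0 1] by simp
    moreover have "path_image ?q = polygon v ` (\<lambda>t. of_int k * t) ` {0..1}"
      by (simp add: path_image_def image_image)
    ultimately show ?thesis
      by (simp add: realization_walk_edges(1)[OF v])
  qed
  ultimately show ?thesis
    using homeomorphic_simple_path_image_circle[of ?q 1 0] by simp
qed

section \<open>The angle along a cycle and lifts of its parametrizations\<close>

text \<open>Wraps the cycle once around the unit circle. The angle is well defined because
  parameters of the same point differ by a multiple of \<open>k\<close>.\<close>

lemma polygon_angle: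
  assumes v: "cyclic_walk k v"
  obtains G :: "real ^ 'v::finite \<Rightarrow> complex"
  where "continuous_on (realization (walk_edges k v)) G"
    and "\<And>t. G (polygon v t) = exp (2 * of_real pi * \<i> * of_real (t / of_int k))"
proof -
  have k: "k \<ge> 3" using v by (simp add: cyclic_walk_def)
  let ?R = "realization (walk_edges k v)"
  let ?E = "\<lambda>t. exp (2 * of_real pi * \<i> * of_real (t / of_int k))"
  define G where "G x = ?E (SOME t. polygon v t = x)" for x
  have G: "G (polygon v t) = ?E t" for t
  proof -
    define s where "s = (SOME s. polygon v s = polygon v t)"
    have "polygon v s = polygon v t"
      unfolding s_def by (rule someI_ex) auto
    then obtain m :: int where "s = t + of_int (m * k)"
      using polygon_inj[OF v] by blast
    then have "s / of_int k = t / of_int k + of_int m"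
      using k by (simp add: field_simps)
    then have "?E s = ?E t"
      by (simp add: exp_eq algebra_simps)
    then show ?thesis
      by (simp add: G_def s_def)
  qed
  have contE: "continuous_on {0..of_int k} ?E"
    using k by (intro continuous_intros) auto
  have "continuous_on ?R G"
  proof -
    \<comment> \<open>Continuity is obtained from closed preimages: these are images under
      \<open>polygon v\<close> of compact sets of parameters.\<close>
    have compact_image: "compact (polygon v ` ({0..of_int k} \<inter> ?E -` B))" if "closed B" for B
    proof (intro compact_continuous_image continuous_on_polygon)
      have "closed (?E -` B \<inter> {0..of_int k})"
        using contE that by (simp add: continuous_on_closed_vimage)
      then show "compact ({0..of_int k} \<inter> ?E -` B)"
        by (metis Int_commute Int_left_absorb compact_Icc compact_Int_closed)
    qed
    have "closed (G -` B \<inter> ?R)" if "closed B" for B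
    proof -
      have "G -` B \<inter> ?R = polygon v ` ({0..of_int k} \<inter> ?E -` B)"
        unfolding realization_walk_edges(1)[OF v] using G by auto
      then show ?thesis
        using compact_image[OF that] compact_imp_closed by metis
    qed
    moreover have "closed ?R"
      unfolding realization_walk_edges(1)[OF v]
      by (intro compact_imp_closed compact_continuous_image continuous_on_polygon) auto
    ultimately show ?thesis
      by (simp add: continuous_on_closed_vimage)
  qed
  with G that show thesis
    by blast
qed

text \<open>\<open>h\<close> is a continuous angle along \<open>p\<close>, scaled so that an edge
  has length 1. The angle map sends \<open>p\<close> to a simple closed curve onto the unit circle;
  its winding number 1 or -1 about the centre gives the total change of \<open>h\<close>, and
  continuity with injectivity gives monotonicity.\<close>

lemma cycle_parametrization_lift:
  fixes v :: "int \<Rightarrow> 'v::finite"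
  assumes v: "cyclic_walk k v" and p: "cycle_parametrization (walk_edges k v) p"
  obtains h where "continuous_on {0..1} h" "\<And>t. t \<in> {0..1} \<Longrightarrow> p t = polygon v (h t)"
    and "strict_mono_on {0..1} h \<and> h 1 = h 0 + of_int k \<or>
         strict_antimono_on {0..1} h \<and> h 1 = h 0 - of_int k"
proof -
  have k: "k \<ge> 3" using v by (simp add: cyclic_walk_def)
  let ?R = "realization (walk_edges k v)"
  have simple: "simple_path p" and loop: "p 1 = p 0" and image: "p ` {0..1} = ?R"
    using p by (auto simp: cycle_parametrization_def pathfinish_def pathstart_def path_image_def)
  obtain G :: "real ^ 'v \<Rightarrow> complex" where G: "continuous_on ?R G"
      "\<And>t. G (polygon v t) = exp (2 * of_real pi * \<i> * of_real (t / of_int k))"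
    using polygon_angle[OF v] by blast
  have contp: "continuous_on {0..1} p"
    using simple by (simp add: simple_path_def path_def)
  have normG: "norm (G x) = 1" if "x \<in> ?R" for x
    using that G(2) unfolding realization_walk_edges(2)[OF v] by auto
  have "continuous_on {0..1} (G \<circ> p)"
    using contp G(1) image by (intro continuous_on_compose) auto
  moreover have "contractible {0..1::real}"
    by (intro convex_imp_contractible) simp
  moreover have "(G \<circ> p) t \<noteq> 0" if "t \<in> {0..1}" for t
    using normG[of "p t"] image that by force
  ultimately obtain L where L: "continuous_on {0..1} L" "\<And>t. t \<in> {0..1} \<Longrightarrow> (G \<circ> p) t = exp (L t)"
    by (metis (no_types, lifting) continuous_logarithm_on_contractible)
  define h where "h t = Im (L t) / (2 * pi) * of_int k" for t
  have L_eq: "L t = 2 * of_real pi * \<i> * of_real (h t / of_int k)" if "t \<in> {0..1}" for t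
  proof -
    have "norm (exp (L t)) = 1"
      using that L(2)[OF that] normG[of "p t"] image by (metis comp_apply imageI)
    then have "Re (L t) = 0"
      by simp
    then show ?thesis
      using k by (simp add: h_def complex_eq_iff)
  qed
  have conth: "continuous_on {0..1} h"
    unfolding h_def by (intro continuous_intros L(1)) auto
  have inj: "x = y" if xy: "x \<in> ?R" "y \<in> ?R" "G x = G y" for x y
  proof -
    obtain s t where st: "x = polygon v s" "y = polygon v t"
      using xy(1,2) unfolding realization_walk_edges(2)[OF v] by (elim rangeE)
    have "exp (2 * of_real pi * \<i> * of_real (s / of_int k)) = exp (2 * of_real pi * \<i> * of_real (t / of_int k))"
      using xy(3) by (simp only: st G(2))
    then obtain m :: int where "complex_of_real (s / of_int k) = of_real (t / of_int k) + of_int m"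
      using eq_exp_add_Ints by blast
    then have "s / of_int k = t / of_int k + of_int m"
      by (metis of_real_add of_real_eq_iff of_real_of_int_eq)
    then have "s = t + of_int m * of_int k"
      using k by (simp add: field_simps)
    then have "s = t + of_int (m * k)"
      by simp
    moreover have "v (i + m * k) = v i" for i
      using v by (simp add: cyclic_walk_def cong_def)
    ultimately show ?thesis
      unfolding st using polygon_periodic[of v "m * k" t] by metis
  qed
  have p_eq: "p t = polygon v (h t)" if "t \<in> {0..1}" for t
  proof (rule inj)
    show "p t \<in> ?R" "polygon v (h t) \<in> ?R"
      using that image unfolding realization_walk_edges(2)[OF v] by auto
    show "G (p t) = G (polygon v (h t))"
      using L(2)[OF that] L_eq[OF that] by (simp add: G(2))
  qed
  have inj_p: "s = t" if "s \<in> {0..1}" "t \<in> {0..1}" "p s = p t" "s \<noteq> 0 \<or> t \<noteq> 1" "s \<noteq> 1 \<or> t \<noteq> 0" for s t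
    using simple that unfolding simple_path_def loop_free_def by blast
  have "winding_number (G \<circ> p) 0 = (h 1 - h 0) / of_int k"
  proof -
    have "winding_number (G \<circ> p) 0 = (L 1 - L 0) / (2 * of_real pi * \<i>)"
      by (rule winding_number_eq_log_difference[OF L])
    also have "\<dots> = (h 1 - h 0) / of_int k"
      using L_eq[of 0] L_eq[of 1] by (simp add: right_diff_distrib[symmetric] diff_divide_distrib)
    finally show ?thesis .
  qed
  moreover have "simple_path (G \<circ> p)"
    unfolding simple_path_def loop_free_def path_def
  proof (intro conjI ballI impI)
    show "continuous_on {0..1} (G \<circ> p)"
      by fact
    fix s t :: real
    assume st: "s \<in> {0..1}" "t \<in> {0..1}" "(G \<circ> p) s = (G \<circ> p) t"
    have "p s = p t"
      using st image by (intro inj) auto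
    with inj_p[OF st(1,2)] show "s = t \<or> s = 0 \<and> t = 1 \<or> s = 1 \<and> t = 0"
      by blast
  qed
  moreover have "path_image (G \<circ> p) = sphere 0 1"
  proof -
    have "path_image (G \<circ> p) = G ` ?R"
      by (metis image image_comp path_image_def)
    also have "\<dots> = sphere 0 1"
    proof (intro equalityI subsetI)
      fix z :: complex assume "z \<in> sphere 0 1"
      then obtain x where "z = exp (\<i> * of_real x)"
        by (metis mem_sphere_0 complex_norm_eq_1_exp)
      then have "z = G (polygon v (x / (2 * pi) * of_int k))"
        using k by (simp add: G(2))
      then show "z \<in> G ` ?R"
        unfolding realization_walk_edges(2)[OF v] by blast
    qed (use normG in auto)
    finally show ?thesis .
  qed
  moreover have "(0::complex) \<in> inside (sphere 0 1)"
    using inside_frontier_eq_interior[of "cball (0::complex) 1"] by simp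
  ultimately have "complex_of_real ((h 1 - h 0) / of_int k) \<in> {1, -1}"
    using simple_closed_path_winding_number_inside[of "G \<circ> p"] by (metis insertCI)
  then have "(h 1 - h 0) / of_int k \<in> {1, -1}"
    by (simp only: insert_iff empty_iff complex_eq_iff) simp
  then have ends: "h 1 = h 0 + of_int k \<or> h 1 = h 0 - of_int k"
    using k by (auto simp: field_simps)
  have inj_h: "inj_on h {0..1}"
  proof (rule inj_onI)
    fix s t :: real assume st: "s \<in> {0..1}" "t \<in> {0..1}" "h s = h t"
    then have "p s = p t"
      by (simp add: p_eq)
    \<comment> \<open>\<open>p\<close> identifies only the parameters 0 and 1, and there
      \<open>h\<close> differs by \<open>k\<close>.\<close>
    moreover have "h 0 \<noteq> h 1"
      using ends k by auto
    ultimately show "s = t"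
      by (intro inj_p st(1,2)) (use st(3) in auto)
  qed
  show thesis
  proof (rule that[OF conth p_eq])
    have "strict_mono_on {0..1} h \<or> strict_antimono_on {0..1} h"
      using injective_eq_monotone_map[OF is_interval_cc conth] inj_h by blast
    then show "strict_mono_on {0..1} h \<and> h 1 = h 0 + of_int k \<or>
         strict_antimono_on {0..1} h \<and> h 1 = h 0 - of_int k"
      using ends k monotone_onD[of "{0..1}" "(<)" "(<)" h 0 1] monotone_onD[of "{0..1}" "(<)" "(>)" h 0 1]
      by (elim disjE) simp_all
  qed
qed

section \<open>The rotation number of a cycle modulo 2\<close>

text \<open>Negation adds the constant \<open>\<i> * of_real pi\<close> to a logarithm and reversal
  exchanges its end values. This is what happens to the chords when an edge or a corner is traversed
  backwards.\<close>

lemma winding_number_uminus_reverse: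
  assumes "continuous_on {0..1} g" "\<And>s. s \<in> {0..1} \<Longrightarrow> g s \<noteq> 0"
    and "\<And>s. s \<in> {0..1} \<Longrightarrow> g' s = - g (1 - s)"
  shows "winding_number g' 0 = - winding_number g 0"
proof -
  have "contractible {0..1::real}"
    by (intro convex_imp_contractible) simp
  then obtain L where L: "continuous_on {0..1} L" "\<And>s. s \<in> {0..1} \<Longrightarrow> g s = exp (L s)"
    using assms(1,2) continuous_logarithm_on_contractible by metis
  have "winding_number g' 0 = ((L (1 - 1) + \<i> * of_real pi) - (L (1 - 0) + \<i> * of_real pi)) / (2 * of_real pi * \<i>)"
  proof (rule winding_number_eq_log_difference)
    show "continuous_on {0..1} (\<lambda>s. L (1 - s) + \<i> * of_real pi)"
      by (intro continuous_intros continuous_on_compose2[OF L(1)]) auto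
    show "g' s = exp (L (1 - s) + \<i> * of_real pi)" if "s \<in> {0..1}" for s
      using that assms(3)[OF that] L(2)[of "1 - s"] by (simp add: exp_add)
  qed
  also have "\<dots> = - winding_number g 0"
    using winding_number_eq_log_difference[OF L] by (simp add: minus_divide_left)
  finally show ?thesis .
qed

lemma winding_number_mod_Ints:
  assumes "continuous_on {0..1} g" "\<And>s. s \<in> {0..1} \<Longrightarrow> g s \<noteq> 0"
    and "g 0 = exp (2 * of_real pi * \<i> * a)" "g 1 = exp (2 * of_real pi * \<i> * b)"
  shows "\<exists>n::int. winding_number g 0 = b - a + of_int n"
proof -
  have "g 1 = exp (2 * of_real pi * \<i> * winding_number g 0) * g 0"
    using winding_number_exp_2pi[of g 0] assms(1,2)
    by (force simp: path_def path_image_def pathstart_def pathfinish_def)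
  then have "exp (2 * of_real pi * \<i> * (winding_number g 0 + a)) = exp (2 * of_real pi * \<i> * b)"
    using assms(3,4) by (simp add: exp_add[symmetric] algebra_simps)
  then obtain n :: int where "winding_number g 0 + a = b + of_int n"
    using eq_exp_add_Ints by blast
  then show ?thesis
    by (intro exI[of _ n]) (simp add: algebra_simps)
qed

lemma compact_realization: "compact (realization (E :: 'v::finite set set))"
  unfolding realization_def
  by (intro compact_UN ballI compact_convex_hull finite_imp_compact) auto

lemma edge_path_in_realization:
  "{u, v} \<in> E \<Longrightarrow> s \<in> {0..1} \<Longrightarrow> edge_path u v s \<in> realization E"
  using convex_hull_edge[of u v] unfolding realization_def by blast

text \<open>A Lebesgue number of the cover by sets of injectivity turns local injectivity into a
  uniform scale \<open>\<eta>\<close>.\<close>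

lemma locally_injective_on_compact:
  fixes f :: "'a::metric_space \<Rightarrow> 'b"
  assumes "compact S" "locally_injective_on f S"
  obtains \<eta> where "0 < \<eta>" "\<And>x y. x \<in> S \<Longrightarrow> y \<in> S \<Longrightarrow> x \<noteq> y \<Longrightarrow> dist x y < \<eta> \<Longrightarrow> f x \<noteq> f y"
proof (cases "S = {}")
  case True
  then show ?thesis using that[of 1] by simp
next
  case False
  obtain U where U: "\<And>x. x \<in> S \<Longrightarrow> open (U x) \<and> x \<in> U x \<and> inj_on f (U x \<inter> S)"
    using assms(2) unfolding locally_injective_on_def by metis
  obtain \<eta> where \<eta>: "0 < \<eta>" "\<And>T. T \<subseteq> S \<Longrightarrow> diameter T < \<eta> \<Longrightarrow> \<exists>B\<in>U ` S. T \<subseteq> B"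
  proof (rule Lebesgue_number_lemma[OF assms(1)])
    show "U ` S \<noteq> {}" "S \<subseteq> \<Union> (U ` S)" "\<And>B. B \<in> U ` S \<Longrightarrow> open B"
      using False U by auto
  qed blast
  show ?thesis
  proof (rule that[OF \<eta>(1)])
    fix x y assume xy: "x \<in> S" "y \<in> S" "x \<noteq> y" "dist x y < \<eta>"
    have "diameter {x, y} \<le> dist x y"
      using diameter_compact_attained[of "{x, y}"] by (auto simp: dist_commute)
    then obtain z where "z \<in> S" "{x, y} \<subseteq> U z"
      using \<eta>(2)[of "{x, y}"] xy by force
    then show "f x \<noteq> f y"
      using U[of z] xy by (auto simp: inj_on_def)
  qed
qed

text \<open>The integers \<open>n\<close> and \<open>m\<close> come from \<open>f\<close> alone,
  before any cycle is chosen. This allows contributions of different cycles through the same edge or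
  corner to be compared.\<close>

lemma rotation_number_cycle:
  fixes f :: "real ^ 'v::finite \<Rightarrow> complex"
  assumes cont: "continuous_on (realization E) f" and "locally_injective_on f (realization E)"
  obtains n :: "'v \<Rightarrow> 'v \<Rightarrow> int" and m :: "'v \<Rightarrow> 'v \<Rightarrow> 'v \<Rightarrow> int" where
    "\<And>u v. {u, v} \<in> E \<Longrightarrow> u \<noteq> v \<Longrightarrow> n v u = - 1 - n u v"
    "\<And>u v w. {u, v} \<in> E \<Longrightarrow> {v, w} \<in> E \<Longrightarrow> u \<noteq> v \<Longrightarrow> v \<noteq> w \<Longrightarrow> u \<noteq> w \<Longrightarrow> m w v u = 1 - m u v w"
    "\<And>k v p. cyclic_walk k v \<Longrightarrow> walk_edges k v \<subseteq> E \<Longrightarrow> cycle_parametrization (walk_edges k v) p \<Longrightarrow>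
       [rotation_number (f \<circ> p) =
        (\<Sum>i<nat k. n (v i) (v (int i + 1)) + m (v i) (v (int i + 1)) (v (int i + 2)))] (mod 2)"
proof -
  let ?R = "realization E"
  obtain \<eta> where \<eta>: "0 < \<eta>" "\<And>x y. x \<in> ?R \<Longrightarrow> y \<in> ?R \<Longrightarrow> x \<noteq> y \<Longrightarrow> dist x y < \<eta> \<Longrightarrow> f x \<noteq> f y"
    using locally_injective_on_compact[OF compact_realization assms(2)] by metis
  \<comment> \<open>Points at parameter distance \<open>\<delta>\<close> along a walk are at
    distance at most \<open>2 * \<delta>\<close>, which is below \<open>\<eta>\<close>, so their
    images differ. As \<open>\<delta> < 1\<close>, a chord passes at most one vertex.\<close>
  define \<delta> where "\<delta> = min (1/2) (\<eta> / 4)"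
  have \<delta>: "0 < \<delta>" "\<delta> < 1" "2 * \<delta> < \<eta>"
    using \<eta>(1) by (auto simp: \<delta>_def)
  have frac_in: "\<delta> * s \<in> {0..1}" "1 - \<delta> + \<delta> * s \<in> {0..1}" "(1 - \<delta>) * s \<in> {0..1}" "\<delta> + (1 - \<delta>) * s \<in> {0..1}"
    if "s \<in> {0..1}" for s
  proof -
    have "0 \<le> \<delta> * s" "\<delta> * s \<le> \<delta>" "0 \<le> (1 - \<delta>) * s" "(1 - \<delta>) * s \<le> 1 - \<delta>"
      using that \<delta> by (auto intro: mult_left_le)
    then show "\<delta> * s \<in> {0..1}" "1 - \<delta> + \<delta> * s \<in> {0..1}" "(1 - \<delta>) * s \<in> {0..1}" "\<delta> + (1 - \<delta>) * s \<in> {0..1}"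
      using \<delta> unfolding atLeastAtMost_iff by linarith+
  qed
  \<comment> \<open>Chords of parameter length \<open>\<delta>\<close> with moving starting point:
    \<open>G\<close> has both ends on one edge, \<open>K\<close> starts on the last piece of the
    edge from \<open>u\<close> to \<open>v\<close> and ends on the first piece of the edge from
    \<open>v\<close> to \<open>w\<close>.\<close>
  define G where "G u v s = f (edge_path u v (\<delta> + (1 - \<delta>) * s)) - f (edge_path u v ((1 - \<delta>) * s))" for u v s
  define K where "K u v w s = f (edge_path v w (\<delta> * s)) - f (edge_path u v (1 - \<delta> + \<delta> * s))" for u v w s
  define \<tau> where "\<tau> u v = winding_number (G u v) 0" for u v
  define \<kappa> where "\<kappa> u v w = winding_number (K u v w) 0" for u v w
  \<comment> \<open>The choice of branch is harmless: the integers \<open>n\<close> and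
    \<open>m\<close> below absorb it, and the values of \<open>A\<close> cancel around a
    cycle.\<close>
  define A where "A u v = Ln (f (edge_path u v \<delta>) - f (vertex_point u)) / (2 * of_real pi * \<i>)" for u v

  have cont_edge: "continuous_on {0..1} (\<lambda>s. f (edge_path u v (g s)))"
    if "{u, v} \<in> E" "continuous_on {0..1} g" "\<And>s. s \<in> {0..1} \<Longrightarrow> g s \<in> {0..1}" for u v and g :: "real \<Rightarrow> real"
    using that by (intro continuous_on_compose2[OF cont] continuous_intros)
      (auto intro: edge_path_in_realization)
  have neq_edge: "f (edge_path u v s) \<noteq> f (edge_path u v t)"
    if "{u, v} \<in> E" "u \<noteq> v" "s \<in> {0..1}" "t \<in> {0..1}" "s \<noteq> t" "\<bar>s - t\<bar> \<le> \<delta>" for u v s t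
  proof (rule \<eta>(2))
    show "edge_path u v s \<noteq> edge_path u v t"
      using that edge_path_component[of u v s v] edge_path_component[of u v t v] by auto
    show "dist (edge_path u v s) (edge_path u v t) < \<eta>"
      using norm_edge_path_diff_le[of u v s t] that \<delta> by (simp add: dist_norm)
  qed (use that edge_path_in_realization in auto)

  have G_cont: "continuous_on {0..1} (G u v)" if "{u, v} \<in> E" for u v
    unfolding G_def using frac_in that by (intro continuous_intros cont_edge) auto
  have G_nz: "G u v s \<noteq> 0" if "{u, v} \<in> E" "u \<noteq> v" "s \<in> {0..1}" for u v s
    using neq_edge[OF that(1,2) frac_in(4,3)[OF that(3)]] \<delta> by (simp add: G_def)
  have K_cont: "continuous_on {0..1} (K u v w)" if "{u, v} \<in> E" "{v, w} \<in> E" for u v w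
    unfolding K_def using frac_in that by (intro continuous_intros cont_edge) auto
  have K_nz: "K u v w s \<noteq> 0"
    if "{u, v} \<in> E" "{v, w} \<in> E" "u \<noteq> v" "v \<noteq> w" "u \<noteq> w" "s \<in> {0..1}" for u v w s
  proof -
    have "f (edge_path v w (\<delta> * s)) \<noteq> f (edge_path u v (1 - \<delta> + \<delta> * s))"
    proof (rule \<eta>(2))
      show "edge_path v w (\<delta> * s) \<noteq> edge_path u v (1 - \<delta> + \<delta> * s)"
      proof
        assume eq: "edge_path v w (\<delta> * s) = edge_path u v (1 - \<delta> + \<delta> * s)"
        \<comment> \<open>The coordinate at \<open>w\<close> forces \<open>s = 0\<close> and the
          coordinate at \<open>u\<close> forces \<open>s = 1\<close>.\<close>
        show False
          using arg_cong[OF eq, of "\<lambda>x. x $ w"] arg_cong[OF eq, of "\<lambda>x. x $ u"] that \<delta>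
          by (auto simp: edge_path_component vertex_point_def axis_def)
      qed
      \<comment> \<open>Both points are measured from the corner \<open>v\<close>; the two bounds
        add up to \<open>2 * \<delta>\<close>.\<close>
      have "norm (edge_path v w (\<delta> * s) - vertex_point v) \<le> 2 * (\<delta> * s)"
        using norm_edge_path_diff_le[of v w "\<delta> * s" 0] that \<delta> by simp
      moreover have "norm (edge_path u v (1 - \<delta> + \<delta> * s) - vertex_point v) \<le> 2 * (\<delta> - \<delta> * s)"
        using norm_edge_path_diff_le[of u v "1 - \<delta> + \<delta> * s" 1] frac_in(2)[OF that(6)] by simp
      ultimately show "dist (edge_path v w (\<delta> * s)) (edge_path u v (1 - \<delta> + \<delta> * s)) < \<eta>"
        using dist_triangle2[of "edge_path v w (\<delta> * s)" "edge_path u v (1 - \<delta> + \<delta> * s)" "vertex_point v"] \<delta>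
        by (simp add: dist_norm)
      show "edge_path v w (\<delta> * s) \<in> ?R" "edge_path u v (1 - \<delta> + \<delta> * s) \<in> ?R"
        by (rule edge_path_in_realization[OF that(2) frac_in(1)[OF that(6)]]
              edge_path_in_realization[OF that(1) frac_in(2)[OF that(6)]])+
    qed
    then show ?thesis
      by (simp add: K_def)
  qed

  have rev: "edge_path v u s = edge_path u v (1 - s)" for u v s
    by (simp add: edge_path_reverse)
  have \<tau>_antisym: "\<tau> v u = - \<tau> u v" if "{u, v} \<in> E" "u \<noteq> v" for u v
    unfolding \<tau>_def
  proof (rule winding_number_uminus_reverse[OF G_cont[OF that(1)] G_nz[OF that]])
    show "G v u s = - G u v (1 - s)" for s
      unfolding G_def rev[of v u] by (simp add: algebra_simps)
  qed
  have \<kappa>_antisym: "\<kappa> w v u = - \<kappa> u v w"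
    if "{u, v} \<in> E" "{v, w} \<in> E" "u \<noteq> v" "v \<noteq> w" "u \<noteq> w" for u v w
    unfolding \<kappa>_def
  proof (rule winding_number_uminus_reverse[OF K_cont[OF that(1,2)] K_nz[OF that]])
    show "K w v u s = - K u v w (1 - s)" for s
      unfolding K_def rev[of v u] rev[of w v] by (simp add: algebra_simps)
  qed

  have A_out: "f (edge_path u v \<delta>) - f (vertex_point u) = exp (2 * of_real pi * \<i> * A u v)"
    if "{u, v} \<in> E" "u \<noteq> v" for u v
    using neq_edge[OF that, of \<delta> 0] \<delta> by (simp add: A_def exp_Ln)
  \<comment> \<open>The chord arriving at \<open>v\<close> is the negative of the one leaving
    \<open>v\<close> towards \<open>u\<close>, hence the half turn.\<close>
  have A_in: "f (vertex_point v) - f (edge_path u v (1 - \<delta>)) = exp (2 * of_real pi * \<i> * (A v u + 1 / 2))"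
    if "{u, v} \<in> E" "u \<noteq> v" for u v
  proof -
    have "f (vertex_point v) - f (edge_path u v (1 - \<delta>)) = - exp (2 * of_real pi * \<i> * A v u)"
      using A_out[of v u] that unfolding rev[of v u] by (simp add: insert_commute algebra_simps)
    also have "\<dots> = exp (2 * of_real pi * \<i> * (A v u + 1 / 2))"
      by (simp add: ring_distribs exp_add)
    finally show ?thesis .
  qed
  have "\<exists>n::int. \<tau> u v = A v u + 1 / 2 - A u v + of_int n" if "{u, v} \<in> E" "u \<noteq> v" for u v
    unfolding \<tau>_def using A_out[OF that] A_in[OF that]
    by (intro winding_number_mod_Ints[OF G_cont[OF that(1)] G_nz[OF that]]) (simp_all add: G_def)
  then obtain n :: "'v \<Rightarrow> 'v \<Rightarrow> int" where
    n: "\<And>u v. {u, v} \<in> E \<Longrightarrow> u \<noteq> v \<Longrightarrow> \<tau> u v = A v u + 1 / 2 - A u v + of_int (n u v)"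
    by metis
  have "\<exists>m::int. \<kappa> u v w = A v w - (A v u + 1 / 2) + of_int m"
    if "{u, v} \<in> E" "{v, w} \<in> E" "u \<noteq> v" "v \<noteq> w" "u \<noteq> w" for u v w
    unfolding \<kappa>_def using A_out[OF that(2,4)] A_in[OF that(1,3)]
    by (intro winding_number_mod_Ints[OF K_cont[OF that(1,2)] K_nz[OF that]]) (simp_all add: K_def)
  then obtain m :: "'v \<Rightarrow> 'v \<Rightarrow> 'v \<Rightarrow> int" where
    m: "\<And>u v w. {u, v} \<in> E \<Longrightarrow> {v, w} \<in> E \<Longrightarrow> u \<noteq> v \<Longrightarrow> v \<noteq> w \<Longrightarrow> u \<noteq> w \<Longrightarrow>
       \<kappa> u v w = A v w - (A v u + 1 / 2) + of_int (m u v w)"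
    by metis

  show thesis
  proof (rule that)
    fix u v assume uv: "{u, v} \<in> E" "u \<noteq> v"
    \<comment> \<open>The terms in \<open>A\<close> cancel and the two half turns add up to
      1.\<close>
    have "of_int (n u v + n v u + 1) = \<tau> u v + \<tau> v u"
      using n[of u v] n[of v u] uv by (simp add: insert_commute)
    also have "\<dots> = 0"
      using \<tau>_antisym[OF uv] by simp
    finally have "n u v + n v u + 1 = 0"
      by (simp only: of_int_eq_0_iff)
    then show "n v u = - 1 - n u v"
      by simp
  next
    fix u v w assume uvw: "{u, v} \<in> E" "{v, w} \<in> E" "u \<noteq> v" "v \<noteq> w" "u \<noteq> w"
    then have wvu: "{w, v} \<in> E" "{v, u} \<in> E" "w \<noteq> v" "v \<noteq> u" "w \<noteq> u"
      by (auto simp: insert_commute)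
    \<comment> \<open>At a corner the half turn is subtracted, hence the opposite sign.\<close>
    have "of_int (m u v w + m w v u - 1) = \<kappa> u v w + \<kappa> w v u"
      using m[OF uvw] m[OF wvu] by simp
    also have "\<dots> = 0"
      using \<kappa>_antisym[OF uvw] by simp
    finally have "m u v w + m w v u - 1 = 0"
      by (simp only: of_int_eq_0_iff)
    then show "m w v u = 1 - m u v w"
      by simp
  next
    fix k v p assume walk: "cyclic_walk k v" "walk_edges k v \<subseteq> E" and p: "cycle_parametrization (walk_edges k v) p"
    have k: "k \<ge> 3" using walk by (simp add: cyclic_walk_def)
    have edge: "{v i, v (i + 1)} \<in> E" for i
    proof -
      have "v i = v (i mod k)" "v (i + 1) = v (i mod k + 1)"
        using walk(1) by (simp_all add: cyclic_walk_def cong_def mod_simps)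
      then show ?thesis
        using walk(2) k by (auto simp: walk_edges_def)
    qed
    note neq = cyclic_walk_Suc_neq[OF walk(1)]
    have in_R: "polygon v t \<in> ?R" for t
      using edge[of "\<lfloor>t\<rfloor>"] unfolding polygon_def
      by (intro edge_path_in_realization) (auto simp: less_imp_le frac_lt_1)
    define c where "c t = f (polygon v t)" for t
    have c_per: "c (t + of_int k) = c t" for t
      unfolding c_def using polygon_periodic[of v k t] cyclic_walk_periodic[OF walk(1)] by simp
    have c_cont: "continuous_on UNIV c"
      unfolding c_def by (intro continuous_on_compose2[OF cont] continuous_on_polygon) (use in_R in auto)
    have c_inj: "c (t + u) \<noteq> c t" if "0 < u" "u \<le> \<delta>" for t u
      unfolding c_def
    proof (intro \<eta>(2) in_R)
      show "polygon v (t + u) \<noteq> polygon v t"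
      proof
        assume "polygon v (t + u) = polygon v t"
        then obtain j :: int where "t + u = t + of_int (j * k)"
          using polygon_inj[OF walk(1)] by blast
        \<comment> \<open>No integer, in particular no multiple of the period, lies strictly between
          0 and 1.\<close>
        then have "0 < real_of_int (j * k)" "real_of_int (j * k) < 1"
          using that \<delta>(2) by linarith+
        then have "0 < j * k" "j * k < 1"
          by (simp_all only: of_int_0_less_iff of_int_less_1_iff)
        then show False by linarith
      qed
      show "dist (polygon v (t + u)) (polygon v t) < \<eta>"
        using norm_polygon_diff_le[of "t + u" t v] that \<delta> by (simp add: dist_norm)
    qed
    obtain \<Theta> r where \<Theta>: "continuous_on (UNIV \<times> {0<..\<delta>}) \<Theta>"
        "\<And>y u. 0 < u \<Longrightarrow> u \<le> \<delta> \<Longrightarrow> c (y + u) - c y = exp (\<Theta> (y, u))"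
        "\<And>y u. 0 < u \<Longrightarrow> u \<le> \<delta> \<Longrightarrow> \<Theta> (y + of_int k, u) - \<Theta> (y, u) = 2 * of_real pi * \<i> * of_int r"
      using chord_logarithm[OF c_cont c_per c_inj \<delta>(1)] by metis
    obtain h where h: "continuous_on {0..1} h" "\<And>t. t \<in> {0..1} \<Longrightarrow> p t = polygon v (h t)"
      and dir: "strict_mono_on {0..1} h \<and> h 1 = h 0 + of_int k \<or>
         strict_antimono_on {0..1} h \<and> h 1 = h 0 - of_int k"
      using cycle_parametrization_lift[OF walk(1) p] by metis
    \<comment> \<open>The direction of \<open>p\<close> relative to the walk decides the sign, which
      is invisible modulo 2.\<close>
    have "rotation_number (f \<circ> p) = 1 * r \<or> rotation_number (f \<circ> p) = - 1 * r"
      using dir rotation_number_reparametrized[OF c_per \<Theta> \<delta>(1) _ h(1), of "f \<circ> p" 1]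
        rotation_number_reparametrized[OF c_per \<Theta> \<delta>(1) _ h(1), of "f \<circ> p" "- 1"] h(2)
      by (elim disjE) (simp_all add: c_def)
    then have parity: "[rotation_number (f \<circ> p) = r] (mod 2)"
      by (auto simp: cong_iff_dvd_diff)

    \<comment> \<open>Chords of the single length \<open>\<delta>\<close> suffice from here on,
      since \<open>r\<close> is the same for all lengths.\<close>
    define \<theta> where "\<theta> y = \<Theta> (y, \<delta>)" for y
    have \<theta>_cont: "continuous_on {0..1} (\<lambda>s. \<theta> (g s))" if "continuous_on {0..1} g" for g :: "real \<Rightarrow> real"
      unfolding \<theta>_def using \<delta> that by (intro continuous_on_compose2[OF \<Theta>(1)] continuous_intros) auto
    have \<theta>: "c (y + \<delta>) - c y = exp (\<theta> y)" for y
      using \<Theta>(2)[of \<delta> y] \<delta> by (simp add: \<theta>_def)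
    have c_edge: "c (of_int i + s) = f (edge_path (v i) (v (i + 1)) s)" if "s \<in> {0..1}" for i s
      using polygon_eq[of i "of_int i + s" v] that by (simp add: c_def)
    \<comment> \<open>While its start runs over one edge, the chord stays on this edge for the time
      \<open>1 - \<delta>\<close> and then passes the corner during the last
      \<open>\<delta>\<close>.\<close>
    have turn: "\<theta> (of_int i + 1) - \<theta> (of_int i) =
        2 * of_real pi * \<i> * (\<tau> (v i) (v (i + 1)) + \<kappa> (v i) (v (i + 1)) (v (i + 2)))" for i
    proof -
      have "\<tau> (v i) (v (i + 1)) =
          (\<theta> (of_int i + (1 - \<delta>) * 1) - \<theta> (of_int i + (1 - \<delta>) * 0)) / (2 * of_real pi * \<i>)"
        unfolding \<tau>_def
      proof (rule winding_number_eq_log_difference)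
        show "G (v i) (v (i + 1)) s = exp (\<theta> (of_int i + (1 - \<delta>) * s))" if "s \<in> {0..1}" for s
          using \<theta>[of "of_int i + (1 - \<delta>) * s"] c_edge[OF frac_in(3)[OF that], of i]
            c_edge[OF frac_in(4)[OF that], of i]
          by (simp add: G_def add_ac)
      qed (intro \<theta>_cont continuous_intros)
      moreover have "\<kappa> (v i) (v (i + 1)) (v (i + 2)) =
          (\<theta> (of_int i + (1 - \<delta> + \<delta> * 1)) - \<theta> (of_int i + (1 - \<delta> + \<delta> * 0))) / (2 * of_real pi * \<i>)"
        unfolding \<kappa>_def
      proof (rule winding_number_eq_log_difference)
        show "K (v i) (v (i + 1)) (v (i + 2)) s = exp (\<theta> (of_int i + (1 - \<delta> + \<delta> * s)))"
          if "s \<in> {0..1}" for s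
          using \<theta>[of "of_int i + (1 - \<delta> + \<delta> * s)"] c_edge[OF frac_in(2)[OF that], of i]
            c_edge[OF frac_in(1)[OF that], of "i + 1"]
          by (simp add: K_def add_ac)
      qed (intro \<theta>_cont continuous_intros)
      ultimately have "2 * of_real pi * \<i> * \<tau> (v i) (v (i + 1)) = \<theta> (of_int i + (1 - \<delta>)) - \<theta> (of_int i)"
        and "2 * of_real pi * \<i> * \<kappa> (v i) (v (i + 1)) (v (i + 2)) = \<theta> (of_int i + 1) - \<theta> (of_int i + (1 - \<delta>))"
        by simp_all
      then show ?thesis
        unfolding distrib_left by simp
    qed
    define N where "N i = n (v (int i)) (v (int i + 1)) + m (v (int i)) (v (int i + 1)) (v (int i + 2))" for i
    \<comment> \<open>The logarithm of the chord leaving the vertex number \<open>i\<close> along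
      the walk. The logarithms of the arriving chords cancel between \<open>\<tau>\<close> and
      \<open>\<kappa>\<close>, and what remains telescopes.\<close>
    define B where "B i = A (v (int i)) (v (int i + 1))" for i
    have "2 * of_real pi * \<i> * of_int r = \<theta> (of_int k) - \<theta> 0"
      using \<Theta>(3)[of \<delta> 0] \<delta> by (simp add: \<theta>_def)
    also have "\<dots> = (\<Sum>i<nat k. \<theta> (real (Suc i)) - \<theta> (real i))"
      using k sum_lessThan_telescope[of "\<lambda>i. \<theta> (real i)" "nat k"] by simp
    also have "\<dots> = (\<Sum>i<nat k. 2 * of_real pi * \<i> *
        (\<tau> (v i) (v (int i + 1)) + \<kappa> (v i) (v (int i + 1)) (v (int i + 2))))"
    proof (rule sum.cong[OF refl])
      show "\<theta> (real (Suc i)) - \<theta> (real i) = 2 * of_real pi * \<i> *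
          (\<tau> (v i) (v (int i + 1)) + \<kappa> (v i) (v (int i + 1)) (v (int i + 2)))" for i
      proof -
        have eq: "real (Suc i) = of_int (int i) + 1" "real i = of_int (int i)"
          by simp_all
        show ?thesis
          unfolding eq by (rule turn)
      qed
    qed
    also have "\<dots> = 2 * of_real pi * \<i> * (\<Sum>i<nat k.
        \<tau> (v i) (v (int i + 1)) + \<kappa> (v i) (v (int i + 1)) (v (int i + 2)))"
      by (simp add: sum_distrib_left)
    finally have "of_int r = (\<Sum>i<nat k. \<tau> (v i) (v (int i + 1)) + \<kappa> (v i) (v (int i + 1)) (v (int i + 2)))"
      by simp
    also have "\<dots> = (\<Sum>i<nat k. of_int (N i) + (B (Suc i) - B i))"
    proof (rule sum.cong[OF refl])
      fix i
      have Suc: "int (Suc i) = int i + 1" "int i + 1 + 1 = int i + 2"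
        by simp_all
      have "\<kappa> (v i) (v (int i + 1)) (v (int i + 2)) =
          A (v (int i + 1)) (v (int i + 2)) - (A (v (int i + 1)) (v i) + 1 / 2) +
           of_int (m (v i) (v (int i + 1)) (v (int i + 2)))"
        using edge[of "int i"] neq[of "int i"] edge[of "int i + 1"] neq(1)[of "int i + 1"]
        by (intro m) (simp_all add: add.assoc)
      moreover have "\<tau> (v i) (v (int i + 1)) =
          A (v (int i + 1)) (v i) + 1 / 2 - A (v i) (v (int i + 1)) + of_int (n (v i) (v (int i + 1)))"
        using edge[of "int i"] neq(1)[of "int i"] by (intro n)
      ultimately show "\<tau> (v i) (v (int i + 1)) + \<kappa> (v i) (v (int i + 1)) (v (int i + 2)) =
          of_int (N i) + (B (Suc i) - B i)"
        unfolding N_def B_def Suc by simp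
    qed
    also have "\<dots> = (\<Sum>i<nat k. of_int (N i)) + (B (nat k) - B 0)"
      by (simp only: sum.distrib sum_lessThan_telescope)
    also have "B (nat k) = B 0"
      using k cyclic_walk_periodic[OF walk(1), of 0] cyclic_walk_periodic[OF walk(1), of 1]
      by (simp add: B_def add.commute[of k 1])
    finally have "of_int r = (of_int (\<Sum>i<nat k. N i) :: complex)"
      by simp
    then have "r = (\<Sum>i<nat k. N i)"
      by (rule of_int_eq_iff[THEN iffD1])
    with parity show "[rotation_number (f \<circ> p) =
        (\<Sum>i<nat k. n (v i) (v (int i + 1)) + m (v i) (v (int i + 1)) (v (int i + 2)))] (mod 2)"
      by (simp only: N_def)
  qed
qed

section \<open>Vertex degrees in a realization homeomorphic to a circle\<close>

lemma punctured_circle_homeomorphic_line: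
  assumes "R homeomorphic sphere (0::complex) 1" "x \<in> R"
  shows "(R - {x}) homeomorphic (UNIV :: real set)"
proof -
  obtain g g' where g: "homeomorphism R (sphere (0::complex) 1) g g'"
    using assms(1) by (auto simp: homeomorphic_def)
  have "inj_on g R" "g ` R = sphere 0 1"
    using g by (auto simp: homeomorphism_def intro: inj_on_inverseI)
  then have "g ` (R - {x}) = sphere 0 1 - {g x}"
    using assms(2) by (simp add: inj_on_image_set_diff[where C = R])
  then have "homeomorphism (R - {x}) (sphere 0 1 - {g x}) g g'"
    by (intro homeomorphism_of_subsets[OF g]) auto
  then have "(R - {x}) homeomorphic (sphere 0 1 - {g x})"
    by (auto simp: homeomorphic_def)
  also have "\<dots> homeomorphic {z::complex. \<i> \<bullet> z = 0}"
    using g assms(2) by (intro homeomorphic_punctured_sphere_hyperplane) (auto simp: homeomorphism_def)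
  also have "homeomorphism {z::complex. \<i> \<bullet> z = 0} (UNIV :: real set) Re of_real"
    by (auto simp: homeomorphism_def image_iff complex_eq_iff intro!: continuous_intros exI[of _ "of_real _"])
  then have "{z::complex. \<i> \<bullet> z = 0} homeomorphic (UNIV :: real set)"
    by (auto simp: homeomorphic_def)
  finally show ?thesis .
qed

text \<open>A circle stays connected when one point is removed. If \<open>w\<close> were the only
  neighbour of \<open>v\<close>, the coordinate at \<open>v\<close> would take the value 1/2 only at
  the midpoint of this edge, while it is 1 at \<open>v\<close> and 0 at \<open>w\<close>.\<close>

lemma circle_realization_no_leaf:
  fixes \<gamma> :: "'v::finite set set"
  assumes circle: "realization \<gamma> homeomorphic sphere (0::complex) 1"
    and simple: "\<And>e. e \<in> \<gamma> \<Longrightarrow> \<exists>u w. u \<noteq> w \<and> e = {u, w}"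
    and vw: "{v, w} \<in> \<gamma>" "v \<noteq> w"
  shows "\<exists>w'. w' \<noteq> w \<and> {v, w'} \<in> \<gamma>"
proof (rule ccontr)
  assume leaf: "\<nexists>w'. w' \<noteq> w \<and> {v, w'} \<in> \<gamma>"
  let ?m = "edge_path v w (1 / 2)" and ?R = "realization \<gamma>"
  have on_edge: "edge_path v w s \<in> ?R" if "s \<in> {0..1}" for s
    using that convex_hull_edge[of v w] vw unfolding realization_def by blast
  have half: "x = ?m" if x: "x \<in> ?R" "x $ v = 1 / 2" for x
  proof -
    obtain e where e: "e \<in> \<gamma>" "x \<in> convex hull (vertex_point ` e)"
      using x(1) unfolding realization_def by blast
    then obtain a b where ab: "a \<noteq> b" "e = {a, b}"
      using simple by blast
    then obtain s where s: "s \<in> {0..1}" "x = edge_path a b s"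
      using e(2) convex_hull_edge[of a b] by auto
    then have "v = a \<or> v = b"
      using that(2) by (auto simp: edge_path_component split: if_splits)
    then show ?thesis
    proof
      assume "v = a"
      then have "b = w"
        using leaf e(1) ab by auto
      moreover have "s = 1 / 2"
        using that(2) \<open>v = a\<close> ab by (simp add: s edge_path_component)
      ultimately show ?thesis
        using \<open>v = a\<close> s(2) by metis
    next
      assume "v = b"
      then have "a = w"
        using leaf e(1) ab by (auto simp: insert_commute)
      moreover have "s = 1 / 2"
        using that(2) \<open>v = b\<close> ab by (simp add: s edge_path_component split: if_splits)
      moreover have "edge_path w v (1 / 2) = ?m"
        using edge_path_reverse[of w v "1 / 2"] by simp
      ultimately show ?thesis
        using \<open>v = b\<close> s(2) by metis
    qed
  qed
  have "?m \<in> ?R"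
    by (rule on_edge) simp
  then have "connected (?R - {?m})"
    using punctured_circle_homeomorphic_line[OF circle] homeomorphic_connectedness connected_UNIV by blast
  then have "connected ((\<lambda>x. x $ v) ` (?R - {?m}))"
    by (rule connected_continuous_image[rotated]) (intro continuous_intros)
  moreover have ends: "vertex_point v \<in> ?R - {?m}" "vertex_point w \<in> ?R - {?m}"
  proof -
    have "vertex_point u \<noteq> ?m" if "u = v \<or> u = w" for u
    proof
      assume "vertex_point u = ?m"
      then have "vertex_point u $ u = ?m $ u" by simp
      then show False
        using that vw by (auto simp: edge_path_component vertex_point_def axis_def)
    qed
    then show "vertex_point v \<in> ?R - {?m}" "vertex_point w \<in> ?R - {?m}"
      using on_edge[of 0] on_edge[of 1] by auto
  qed
  moreover have "vertex_point v $ v = 1" "vertex_point w $ v = 0"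
    using vw(2) by (simp_all add: vertex_point_def axis_def)
  ultimately have "1 / 2 \<in> (\<lambda>x. x $ v) ` (?R - {?m})"
    using connectedD_interval[of "(\<lambda>x. x $ v) ` (?R - {?m})" 0 1 "1 / 2"] by force
  then obtain x where "x \<in> ?R - {?m}" "x $ v = 1 / 2"
    by (metis (no_types, lifting) imageE)
  then show False
    using half by blast
qed

text \<open>Both intervals contain all sufficiently large numbers.\<close>

lemma connected_not_bdd_above_Int:
  fixes I J :: "real set"
  assumes "connected I" "connected J" "\<not> bdd_above I" "\<not> bdd_above J"
  shows "I \<inter> J \<noteq> {}"
proof -
  obtain a b where ab: "a \<in> I" "b \<in> J"
    using assms(3,4) by (metis bdd_above_empty equals0I)
  obtain c d where "c \<in> I" "max a b \<le> c" "d \<in> J" "max a b \<le> d"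
    using assms(3,4) by (meson bdd_above.I linear)
  then have "max a b \<in> I" "max a b \<in> J"
    using connectedD_interval[OF assms(1) ab(1), of c "max a b"]
      connectedD_interval[OF assms(2) ab(2), of d "max a b"] by auto
  then show ?thesis by blast
qed

lemma connected_not_bdd_below_Int:
  fixes I J :: "real set"
  assumes "connected I" "connected J" "\<not> bdd_below I" "\<not> bdd_below J"
  shows "I \<inter> J \<noteq> {}"
proof -
  have "connected (uminus ` I)" "connected (uminus ` J)"
    using assms(1,2) by (auto intro!: connected_continuous_image continuous_intros)
  moreover have "\<not> bdd_above (uminus ` I)" "\<not> bdd_above (uminus ` J)"
    using assms(3,4) by (simp_all add: bdd_above_uminus)
  ultimately have "uminus ` I \<inter> uminus ` J \<noteq> {}"
    by (rule connected_not_bdd_above_Int)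
  then show ?thesis by auto
qed

text \<open>Without \<open>v\<close> the circle is a line, and the edges at \<open>v\<close> without
  this end point become disjoint intervals. None of them is bounded, because each edge tends to the
  missing point; a line has two ends, so at most two such intervals fit.\<close>

lemma circle_realization_no_triod:
  fixes \<gamma> :: "'v::finite set set"
  assumes circle: "realization \<gamma> homeomorphic sphere (0::complex) 1"
    and W: "\<And>w. w \<in> W \<Longrightarrow> w \<noteq> v \<and> {v, w} \<in> \<gamma>"
  shows "card W \<le> 2"
proof (rule ccontr)
  assume "\<not> card W \<le> 2"
  let ?R = "realization \<gamma>"
  define arm where "arm w = edge_path v w ` {0<..1}" for w
  have on_edge: "edge_path v w s \<in> ?R" if "s \<in> {0..1}" "w \<in> W" for s w
    using that convex_hull_edge[of v w] W[of w] unfolding realization_def by blast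
  have arm_sub: "arm w \<subseteq> ?R - {vertex_point v}" if "w \<in> W" for w
  proof -
    have "edge_path v w s \<noteq> vertex_point v" if "s \<in> {0<..1}" for s
    proof
      assume "edge_path v w s = vertex_point v"
      then have "edge_path v w s $ w = vertex_point v $ w" by simp
      then show False
        using that W[OF \<open>w \<in> W\<close>] by (auto simp: edge_path_component vertex_point_def axis_def)
    qed
    then show ?thesis
      using on_edge[of _ w] that by (auto simp: arm_def)
  qed
  have arm_disjoint: "arm w \<inter> arm w' = {}" if "w \<in> W" "w' \<in> W" "w \<noteq> w'" for w w'
  proof -
    have "edge_path v w s \<noteq> edge_path v w' t" if "s \<in> {0<..1}" for s t
    proof
      assume "edge_path v w s = edge_path v w' t"
      then have "edge_path v w s $ w = edge_path v w' t $ w" by simp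
      then show False
        using that W[OF \<open>w \<in> W\<close>] \<open>w \<noteq> w'\<close> by (auto simp: edge_path_component)
    qed
    then show ?thesis
      by (auto simp: arm_def)
  qed
  obtain w0 where "w0 \<in> W"
    using \<open>\<not> card W \<le> 2\<close> by (metis card.empty equals0I zero_le)
  then have "vertex_point v \<in> ?R"
    using on_edge[of 0 w0] by simp
  then have "(?R - {vertex_point v}) homeomorphic (UNIV :: real set)"
    by (rule punctured_circle_homeomorphic_line[OF circle])
  then obtain \<phi> \<psi> where hom: "homeomorphism (?R - {vertex_point v}) (UNIV :: real set) \<phi> \<psi>"
    unfolding homeomorphic_def by blast
  define I where "I w = \<phi> ` arm w" for w
  have conn: "connected (I w)" if "w \<in> W" for w
    unfolding I_def
  proof (rule connected_continuous_image)
    show "continuous_on (arm w) \<phi>"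
      using hom arm_sub[OF that] continuous_on_subset by (auto simp: homeomorphism_def)
    show "connected (arm w)"
      unfolding arm_def by (intro connected_continuous_image continuous_intros) auto
  qed
  have unbounded: "\<not> (bdd_above (I w) \<and> bdd_below (I w))" if "w \<in> W" for w
  proof
    assume "bdd_above (I w) \<and> bdd_below (I w)"
    then obtain a b where ab: "I w \<subseteq> {a..b}"
      unfolding bdd_above_def bdd_below_def by (meson atLeastAtMost_iff subsetI)
    \<comment> \<open>If the interval were bounded, the arm would lie in a compact set avoiding
      \<open>v\<close>, and so would its limit point \<open>v\<close>.\<close>
    have \<psi>: "continuous_on {a..b} \<psi>" "\<psi> ` {a..b} \<subseteq> ?R - {vertex_point v}"
    proof -
      have "continuous_on UNIV \<psi>" "range \<psi> = ?R - {vertex_point v}"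
        using hom by (auto simp: homeomorphism_def)
      then show "continuous_on {a..b} \<psi>" "\<psi> ` {a..b} \<subseteq> ?R - {vertex_point v}"
        using continuous_on_subset by blast+
    qed
    have "closed (\<psi> ` {a..b})"
      using \<psi>(1) by (intro compact_imp_closed compact_continuous_image) auto
    moreover have "edge_path v w s \<in> \<psi> ` {a..b}" if "s \<in> {0<..1}" for s
    proof -
      have "edge_path v w s \<in> arm w"
        using that by (simp add: arm_def)
      then have "\<phi> (edge_path v w s) \<in> {a..b}" "\<psi> (\<phi> (edge_path v w s)) = edge_path v w s"
        using ab hom arm_sub[OF \<open>w \<in> W\<close>] by (auto simp: I_def homeomorphism_def)
      then show ?thesis by (metis imageI)
    qed
    then have "\<forall>\<^sub>F s in at_right 0. edge_path v w s \<in> \<psi> ` {a..b}"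
      using eventually_at_right_real[of 0 "1::real"] by (auto elim!: eventually_mono)
    moreover have "(edge_path v w \<longlongrightarrow> edge_path v w 0) (at_right 0)"
    proof -
      have "continuous_on UNIV (edge_path v w)"
        by (intro continuous_intros)
      then have "(edge_path v w \<longlongrightarrow> edge_path v w 0) (at 0)"
        unfolding continuous_on_def by blast
      then show ?thesis
        by (rule tendsto_within_subset) simp
    qed
    ultimately have "edge_path v w 0 \<in> \<psi> ` {a..b}"
      by (intro Lim_in_closed_set[of _ "edge_path v w" "at_right 0"]) auto
    then show False
      using \<psi>(2) by auto
  qed
  have disj: "I w \<inter> I w' = {}" if "w \<in> W" "w' \<in> W" "w \<noteq> w'" for w w'
  proof -
    have "inj_on \<phi> (?R - {vertex_point v})"
      using hom by (metis homeomorphism_def inj_on_inverseI)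
    then show ?thesis
      using arm_disjoint[OF that] arm_sub that unfolding I_def
      by (metis image_empty inj_on_image_Int)
  qed
  have same_above: "w = w'" if "w \<in> W" "w' \<in> W" "\<not> bdd_above (I w)" "\<not> bdd_above (I w')" for w w'
    using disj[OF that(1,2)] connected_not_bdd_above_Int[OF conn[OF that(1)] conn[OF that(2)] that(3,4)] by blast
  have same_below: "w = w'" if "w \<in> W" "w' \<in> W" "\<not> bdd_below (I w)" "\<not> bdd_below (I w')" for w w'
    using disj[OF that(1,2)] connected_not_bdd_below_Int[OF conn[OF that(1)] conn[OF that(2)] that(3,4)] by blast
  have one: "card {w \<in> W. \<not> bdd_above (I w)} \<le> 1" "card {w \<in> W. \<not> bdd_below (I w)} \<le> 1"
    using same_above same_below by (simp_all add: card_le_Suc0_iff_eq)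
  have "W = {w \<in> W. \<not> bdd_above (I w)} \<union> {w \<in> W. \<not> bdd_below (I w)}"
    using unbounded by auto
  then have "card W \<le> card {w \<in> W. \<not> bdd_above (I w)} + card {w \<in> W. \<not> bdd_below (I w)}"
    by (metis card_Un_le)
  with one \<open>\<not> card W \<le> 2\<close> show False
    by linarith
qed

section \<open>Cycles of the complete bipartite graph\<close>

definition bipartite_edges :: "(3 \<Rightarrow> 3 \<Rightarrow> bool) \<Rightarrow> (3 + 3) set set" where
  "bipartite_edges r = {{Inl x, Inr y} | x y. r x y}"

lemma mem_bipartite_edges [simp]: "{Inl x, Inr y} \<in> bipartite_edges r \<longleftrightarrow> r x y" "{Inr y, Inl x} \<in> bipartite_edges r \<longleftrightarrow> r x y"
  by (auto simp: bipartite_edges_def doubleton_eq_iff)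

lemma bipartite_edges_disj: "bipartite_edges (\<lambda>x y. P x y \<or> Q x y) = bipartite_edges P \<union> bipartite_edges Q"
  unfolding bipartite_edges_def by blast

lemma bipartite_edges_single: "bipartite_edges (\<lambda>x y. x = a \<and> y = b) = {{Inl a, Inr b}}"
  unfolding bipartite_edges_def by blast

lemma ex_3: "(\<exists>i::3. P i) \<longleftrightarrow> P 1 \<or> P 2 \<or> P 3"
  by (metis exhaust_3)

text \<open>Every row and column has no or two entries. If a row is empty, the other two coincide
  and have no or two entries. Otherwise the missing entries form a permutation, and every
  permutation of the residues modulo 3 is \<open>c + x\<close> or \<open>c + 2 * x\<close>.\<close>

lemma two_regular_relation_3:
  fixes r :: "3 \<Rightarrow> 3 \<Rightarrow> bool"
  assumes row: "\<And>i j. r i j \<Longrightarrow> \<exists>j'. j' \<noteq> j \<and> r i j'" "\<And>i. \<exists>j. \<not> r i j"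
    and col: "\<And>i j. r i j \<Longrightarrow> \<exists>i'. i' \<noteq> i \<and> r i' j" "\<And>j. \<exists>i. \<not> r i j"
  shows "r = (\<lambda>_ _. False) \<or> (\<exists>i j. r = (\<lambda>x y. x \<noteq> i \<and> y \<noteq> j)) \<or>
    (\<exists>c. r = (\<lambda>x y. y \<noteq> c + x)) \<or> (\<exists>c. r = (\<lambda>x y. y \<noteq> c + 2 * x))"
proof -
  have row_cases: "\<not> r i 1 \<and> \<not> r i 2 \<and> \<not> r i 3 \<or> r i 1 \<and> r i 2 \<and> \<not> r i 3 \<or>
      r i 1 \<and> \<not> r i 2 \<and> r i 3 \<or> \<not> r i 1 \<and> r i 2 \<and> r i 3" for i
    using row(1)[of i 1] row(1)[of i 2] row(1)[of i 3] row(2)[of i] by (auto simp: ex_3)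
  have col_cases: "\<not> r 1 j \<and> \<not> r 2 j \<and> \<not> r 3 j \<or> r 1 j \<and> r 2 j \<and> \<not> r 3 j \<or>
      r 1 j \<and> \<not> r 2 j \<and> r 3 j \<or> \<not> r 1 j \<and> r 2 j \<and> r 3 j" for j
    using col(1)[of 1 j] col(1)[of 2 j] col(1)[of 3 j] col(2)[of j] by (auto simp: ex_3)
  show ?thesis
    \<comment> \<open>With the quantifiers expanded the claim is propositional in the nine truth
      values of \<open>r\<close>.\<close>
    unfolding fun_eq_iff ex_3 forall_3
    using row_cases[of 1] row_cases[of 2] row_cases[of 3] col_cases[of 1] col_cases[of 2] col_cases[of 3]
    by simp sat
qed

text \<open>Positions sharing an edge but not their first vertex would run it in opposite
  directions, which the distinctness of vertices two steps apart forbids.\<close>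

lemma card_walk_edges:
  assumes v: "cyclic_walk k v"
  shows "card (walk_edges k v) = nat k"
proof -
  have "inj_on (\<lambda>i. {v i, v (i + 1)}) {0..<k}"
  proof (rule inj_onI)
    fix i j assume ij: "i \<in> {0..<k}" "j \<in> {0..<k}" and eq: "{v i, v (i + 1)} = {v j, v (j + 1)}"
    have "v i = v j"
    proof (rule ccontr)
      assume "v i \<noteq> v j"
      then have "v i = v (j + 1)" "v (i + 1) = v j"
        using eq by (auto simp: doubleton_eq_iff)
      then have "[i = j + 1] (mod k)" "v (i + 1) = v j"
        using v by (auto simp: cyclic_walk_def)
      then have "v (i + 1) = v (j + 1 + 1)"
        using v cong_add_rcancel[of i 1 "j + 1" k] by (simp add: cyclic_walk_def)
      then show False
        using \<open>v (i + 1) = v j\<close> cyclic_walk_Suc_neq(2)[OF v, of j] by (simp add: add.assoc)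
    qed
    then show "i = j"
      using v ij by (auto simp: cyclic_walk_def cong_def)
  qed
  then show ?thesis
    by (simp add: walk_edges_def card_image)
qed

section \<open>Closed walks given by lists of vertices\<close>

definition list_walk :: "'a list \<Rightarrow> int \<Rightarrow> 'a" where
  "list_walk vs t = vs ! nat (t mod int (length vs))"

lemma cyclic_walk_list_walk:
  assumes "distinct vs" "3 \<le> length vs"
  shows "cyclic_walk (int (length vs)) (list_walk vs)"
  unfolding cyclic_walk_def
proof (intro conjI allI)
  fix i j :: int
  have lt: "nat (t mod int (length vs)) < length vs" for t
  proof -
    have "0 \<le> t mod int (length vs)" "t mod int (length vs) < int (length vs)"
      using assms(2) by (auto intro!: pos_mod_bound pos_mod_sign)
    then show ?thesis
      by linarith
  qed
  have "list_walk vs i = list_walk vs j \<longleftrightarrow> nat (i mod int (length vs)) = nat (j mod int (length vs))"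
    unfolding list_walk_def by (rule nth_eq_iff_index_eq[OF assms(1) lt lt])
  also have "\<dots> \<longleftrightarrow> [i = j] (mod int (length vs))"
  proof -
    have "0 \<le> t mod int (length vs)" for t
      using assms(2) by (auto intro!: pos_mod_sign)
    then show ?thesis
      by (simp add: cong_def eq_nat_nat_iff)
  qed
  finally show "list_walk vs i = list_walk vs j \<longleftrightarrow> [i = j] (mod int (length vs))" .
qed (use assms(2) in simp)

definition square :: "3 \<times> 3 \<Rightarrow> (3 + 3) list" where
  "square = (\<lambda>(i, j). [Inl (i + 1), Inr (j + 1), Inl (i + 2), Inr (j + 2)])"

text \<open>Indices are residues modulo 3: \<open>square (i, j)\<close> avoids the vertices \<open>Inl i\<close> and \<open>Inr j\<close>, and
  \<open>hexagon (c, s)\<close> with \<open>s = \<plusminus>1\<close> avoids the perfect matching \<open>y = c + s * x\<close>.\<close>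

definition hexagon :: "3 \<times> 3 \<Rightarrow> (3 + 3) list" where
  "hexagon = (\<lambda>(c, s). [Inl 3, Inr (c + s), Inl 2, Inr c, Inl 1, Inr (c + 2 * s)])"

lemma walk_edges_square:
  "walk_edges 4 (list_walk (square (i, j))) = bipartite_edges (\<lambda>x y. x \<noteq> i \<and> y \<noteq> j)"
proof -
  have "{0..<4::int} = {0, 1, 2, 3}"
    by auto
  then have "walk_edges 4 (list_walk (square (i, j))) =
      {{Inl (i + 1), Inr (j + 1)}, {Inl (i + 2), Inr (j + 1)}, {Inl (i + 2), Inr (j + 2)}, {Inl (i + 1), Inr (j + 2)}}"
    by (simp add: walk_edges_def list_walk_def square_def insert_commute)
  also have "\<dots> = bipartite_edges (\<lambda>x y. (x = i + 1 \<or> x = i + 2) \<and> (y = j + 1 \<or> y = j + 2))"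
    by (auto simp: bipartite_edges_def)
  also have "(\<lambda>x y. (x = i + 1 \<or> x = i + 2) \<and> (y = j + 1 \<or> y = j + 2)) = (\<lambda>x y. x \<noteq> i \<and> y \<noteq> j)"
  proof -
    have "(x = i + 1 \<or> x = i + 2) \<longleftrightarrow> x \<noteq> i" for x i :: 3
      using exhaust_3[of x] exhaust_3[of i] by (elim disjE) simp_all
    then show ?thesis by simp
  qed
  finally show ?thesis .
qed

text \<open>Opposite vertices of the hexagon are the pairs of the removed matching, so its sides are
  all the edges outside the matching.\<close>

lemma walk_edges_hexagon:
  assumes "s \<in> {1, 2}"
  shows "walk_edges 6 (list_walk (hexagon (c, s))) = bipartite_edges (\<lambda>x y. y \<noteq> c + s * x)"
proof -
  have "{0..<6::int} = {0, 1, 2, 3, 4, 5}"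
    by auto
  then have "walk_edges 6 (list_walk (hexagon (c, s))) =
      {{Inl 3, Inr (c + s)}, {Inl 2, Inr (c + s)}, {Inl 2, Inr c}, {Inl 1, Inr c},
       {Inl 1, Inr (c + 2 * s)}, {Inl 3, Inr (c + 2 * s)}}"
    by (simp add: walk_edges_def list_walk_def hexagon_def insert_commute)
  also have "\<dots> = bipartite_edges (\<lambda>x y. x = 3 \<and> y = c + s \<or> x = 2 \<and> y = c + s \<or> x = 2 \<and> y = c \<or> x = 1 \<and> y = c \<or>
      x = 1 \<and> y = c + 2 * s \<or> x = 3 \<and> y = c + 2 * s)"
    by (simp only: bipartite_edges_disj bipartite_edges_single Un_insert_left Un_empty_left)
  also have "(\<lambda>x y. x = 3 \<and> y = c + s \<or> x = 2 \<and> y = c + s \<or> x = 2 \<and> y = c \<or> x = 1 \<and> y = c \<or>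
      x = 1 \<and> y = c + 2 * s \<or> x = 3 \<and> y = c + 2 * s) = (\<lambda>x y. y \<noteq> c + s * x)"
  proof (intro ext)
    fix x y
    have "s = 1 \<or> s = 2" using assms by simp
    then show "(x = 3 \<and> y = c + s \<or> x = 2 \<and> y = c + s \<or> x = 2 \<and> y = c \<or> x = 1 \<and> y = c \<or>
      x = 1 \<and> y = c + 2 * s \<or> x = 3 \<and> y = c + 2 * s) = (y \<noteq> c + s * x)"
      using exhaust_3[of x] exhaust_3[of y] exhaust_3[of c] by (elim disjE) simp_all
  qed
  finally show ?thesis .
qed

lemma distinct_square: "distinct (square (i, j))"
  by (simp add: square_def)

lemma distinct_hexagon:
  assumes "s \<in> {1, 2}"
  shows "distinct (hexagon (c, s))"
proof -
  have "s = 1 \<or> s = 2" using assms by simp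
  then show ?thesis
    using exhaust_3[of c] by (elim disjE) (simp_all add: hexagon_def)
qed

lemma inj_square: "inj (\<lambda>q. walk_edges 4 (list_walk (square q)))"
proof (rule injI, clarify)
  fix i j i' j'
  assume eq: "walk_edges 4 (list_walk (square (i, j))) = walk_edges 4 (list_walk (square (i', j')))"
  have "x \<noteq> i \<and> y \<noteq> j \<longleftrightarrow> x \<noteq> i' \<and> y \<noteq> j'" for x y
    using arg_cong[OF eq, of "\<lambda>\<gamma>. {Inl x, Inr y} \<in> \<gamma>"] by (simp add: walk_edges_square)
  \<comment> \<open>Testing with an index that differs from both \<open>i\<close> and
    \<open>i'\<close> isolates the condition on \<open>y\<close>; the same works for the other
    coordinate.\<close>
  moreover have "\<exists>x. x \<noteq> i \<and> x \<noteq> i'" for i i' :: 3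
    unfolding ex_3 using exhaust_3[of i] exhaust_3[of i'] by (elim disjE) simp_all
  ultimately show "i = i' \<and> j = j'"
    by metis
qed

lemma inj_hexagon: "inj_on (\<lambda>q. walk_edges 6 (list_walk (hexagon q))) (UNIV \<times> {1, 2})"
proof (rule inj_onI, clarify)
  fix c s c' s' :: 3
  assume s: "s \<in> {1, 2}" "s' \<in> {1, 2}"
    and eq: "walk_edges 6 (list_walk (hexagon (c, s))) = walk_edges 6 (list_walk (hexagon (c', s')))"
  have "y \<noteq> c + s * x \<longleftrightarrow> y \<noteq> c' + s' * x" for x y
    using arg_cong[OF eq, of "\<lambda>\<gamma>. {Inl x, Inr y} \<in> \<gamma>"] s by (simp add: walk_edges_hexagon)
  then have "c + s * x = c' + s' * x" for x
    by metis
  \<comment> \<open>An affine map is determined by its values at 0 and 1.\<close>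
  from this[of 0] this[of 1] show "c = c' \<and> s = s'"
    by simp
qed

section \<open>Parity of the sums over squares and hexagons\<close>

text \<open>Residues are brought to the representatives 1, 2, 3 over which \<open>sum_3\<close>
  expands, so that equal summands become syntactically equal.\<close>

lemma numeral_3_reduce: "(4::3) = 1" "(5::3) = 2" "(6::3) = 3" "(7::3) = 1"
  by simp_all

text \<open>In the chosen directions every edge is traversed twice each way and contributes -2, and
  every corner once each way and contributes 1. With 9 edges and 18 corners the sum is exactly
  0.\<close>

lemma sum_squares_even:
  fixes n :: "3 + 3 \<Rightarrow> 3 + 3 \<Rightarrow> int" and m :: "3 + 3 \<Rightarrow> 3 + 3 \<Rightarrow> 3 + 3 \<Rightarrow> int"
  assumes n: "\<And>i j. n (Inr j) (Inl i) = - 1 - n (Inl i) (Inr j)"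
    and m: "\<And>i j j'. j \<noteq> j' \<Longrightarrow> m (Inr j') (Inl i) (Inr j) = 1 - m (Inr j) (Inl i) (Inr j')"
       "\<And>i i' j. i \<noteq> i' \<Longrightarrow> m (Inl i') (Inr j) (Inl i) = 1 - m (Inl i) (Inr j) (Inl i')"
  shows "[(\<Sum>q\<in>UNIV \<times> UNIV. \<Sum>i<nat 4. let v = list_walk (square q) in
    n (v i) (v (int i + 1)) + m (v i) (v (int i + 1)) (v (int i + 2))) = 0] (mod 2)"
proof -
  \<comment> \<open>One direction of each corner serves as reference, and the other is rewritten
    through it.\<close>
  have m': "m (Inr 2) (Inl i) (Inr 1) = 1 - m (Inr 1) (Inl i) (Inr 2)"
      "m (Inr 3) (Inl i) (Inr 1) = 1 - m (Inr 1) (Inl i) (Inr 3)"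
      "m (Inr 3) (Inl i) (Inr 2) = 1 - m (Inr 2) (Inl i) (Inr 3)"
      "m (Inl 2) (Inr i) (Inl 1) = 1 - m (Inl 1) (Inr i) (Inl 2)"
      "m (Inl 3) (Inr i) (Inl 1) = 1 - m (Inl 1) (Inr i) (Inl 3)"
      "m (Inl 3) (Inr i) (Inl 2) = 1 - m (Inl 2) (Inr i) (Inl 3)" for i
    by (rule m; simp)+
  have four: "{..<nat 4} = {0, 1, 2, 3}"
    by auto
  show ?thesis
    unfolding sum.cartesian_product' four
    by (simp add: sum_3 list_walk_def square_def n m' numeral_3_reduce Let_def)
qed

text \<open>Again every edge contributes -2, and each of the 9 corners at vertices
  \<open>Inl i\<close> contributes 1. The 9 corners at vertices \<open>Inr j\<close> are traversed
  twice in the same direction and contribute even numbers. Modulo 2 this leaves -18 + 9.\<close>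

lemma sum_hexagons_odd:
  fixes n :: "3 + 3 \<Rightarrow> 3 + 3 \<Rightarrow> int" and m :: "3 + 3 \<Rightarrow> 3 + 3 \<Rightarrow> 3 + 3 \<Rightarrow> int"
  assumes n: "\<And>i j. n (Inr j) (Inl i) = - 1 - n (Inl i) (Inr j)"
    and m: "\<And>i j j'. j \<noteq> j' \<Longrightarrow> m (Inr j') (Inl i) (Inr j) = 1 - m (Inr j) (Inl i) (Inr j')"
       "\<And>i i' j. i \<noteq> i' \<Longrightarrow> m (Inl i') (Inr j) (Inl i) = 1 - m (Inl i) (Inr j) (Inl i')"
  shows "[(\<Sum>q\<in>UNIV \<times> {1, 2}. \<Sum>i<nat 6. let v = list_walk (hexagon q) in
    n (v i) (v (int i + 1)) + m (v i) (v (int i + 1)) (v (int i + 2))) = 1] (mod 2)"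
proof -
  have m': "m (Inr 2) (Inl i) (Inr 1) = 1 - m (Inr 1) (Inl i) (Inr 2)"
      "m (Inr 3) (Inl i) (Inr 1) = 1 - m (Inr 1) (Inl i) (Inr 3)"
      "m (Inr 3) (Inl i) (Inr 2) = 1 - m (Inr 2) (Inl i) (Inr 3)"
      "m (Inl 2) (Inr i) (Inl 1) = 1 - m (Inl 1) (Inr i) (Inl 2)"
      "m (Inl 3) (Inr i) (Inl 1) = 1 - m (Inl 1) (Inr i) (Inl 3)"
      "m (Inl 3) (Inr i) (Inl 2) = 1 - m (Inl 2) (Inr i) (Inl 3)" for i
    by (rule m; simp)+
  have six: "{..<nat 6} = {0, 1, 2, 3, 4, 5}"
    by auto
  show ?thesis
    unfolding sum.cartesian_product' six
    by (simp add: sum_3 list_walk_def hexagon_def n m' numeral_3_reduce Let_def cong_iff_dvd_diff)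
qed

section \<open>Classification of the cycles of \<open>K33\<close>\<close>

lemma cyclic_walk_square: "cyclic_walk 4 (list_walk (square q))"
  using cyclic_walk_list_walk[of "square q"] distinct_square[of "fst q" "snd q"]
  by (cases q) (simp add: square_def)

lemma cyclic_walk_hexagon:
  assumes "q \<in> UNIV \<times> {1, 2}"
  shows "cyclic_walk 6 (list_walk (hexagon q))"
proof -
  obtain c s where q: "q = (c, s)" "s \<in> {1, 2}"
    using assms by blast
  then have "cyclic_walk (int (length (hexagon q))) (list_walk (hexagon q))"
    by (intro cyclic_walk_list_walk) (simp only: q distinct_hexagon, simp add: hexagon_def q(1))
  then show ?thesis
    by (simp add: hexagon_def q(1))
qed

lemma bipartite_edges_subset_K33: "bipartite_edges r \<subseteq> K33"
  unfolding bipartite_edges_def K33_def by blast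

text \<open>In a circle every vertex has degree 0 or 2, which leaves only the relations of
  \<open>two_regular_relation_3\<close>. These degrees do not exclude the empty set; it is separated
  later by its number of edges.\<close>

lemma cycle_K33_cases:
  assumes circle: "realization \<gamma> homeomorphic sphere (0::complex) 1" and K33: "\<gamma> \<subseteq> K33"
  shows "\<gamma> = {} \<or> (\<exists>i j. \<gamma> = walk_edges 4 (list_walk (square (i, j)))) \<or>
    (\<exists>c. \<exists>s\<in>{1, 2}. \<gamma> = walk_edges 6 (list_walk (hexagon (c, s))))"
proof -
  define r where "r x y \<longleftrightarrow> {Inl x, Inr y} \<in> \<gamma>" for x y
  have \<gamma>: "\<gamma> = bipartite_edges r"
  proof
    show "\<gamma> \<subseteq> bipartite_edges r"
    proof
      fix e assume "e \<in> \<gamma>"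
      then obtain x y where "e = {Inl x, Inr y}"
        using K33 by (auto simp: K33_def)
      with \<open>e \<in> \<gamma>\<close> show "e \<in> bipartite_edges r"
        unfolding bipartite_edges_def r_def by blast
    qed
    show "bipartite_edges r \<subseteq> \<gamma>"
      unfolding bipartite_edges_def r_def by blast
  qed
  have simple: "\<exists>u w. u \<noteq> w \<and> e = {u, w}" if e: "e \<in> \<gamma>" for e
  proof -
    obtain x y where "e = {Inl x, Inr y}"
      using e K33 unfolding K33_def by blast
    then show ?thesis
      by (intro exI[of _ "Inl x"] exI[of _ "Inr y"]) simp
  qed
  have no_Inl_Inl: "{Inl x, Inl x'} \<notin> \<gamma>" and no_Inr_Inr: "{Inr y, Inr y'} \<notin> \<gamma>" for x x' y y'
    using K33 by (auto simp: K33_def doubleton_eq_iff)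
  have "r = (\<lambda>_ _. False) \<or> (\<exists>i j. r = (\<lambda>x y. x \<noteq> i \<and> y \<noteq> j)) \<or>
    (\<exists>c. r = (\<lambda>x y. y \<noteq> c + x)) \<or> (\<exists>c. r = (\<lambda>x y. y \<noteq> c + 2 * x))"
  proof (rule two_regular_relation_3)
    fix i j assume "r i j"
    then have edge: "{Inl i, Inr j} \<in> \<gamma>" "{Inr j, Inl i} \<in> \<gamma>"
      by (simp_all add: r_def insert_commute)
    obtain w where w: "w \<noteq> Inr j" "{Inl i, w} \<in> \<gamma>"
      using circle_realization_no_leaf[OF circle simple edge(1)] by auto
    then show "\<exists>j'. j' \<noteq> j \<and> r i j'"
      using no_Inl_Inl by (cases w) (auto simp: r_def)
    obtain w where w: "w \<noteq> Inl i" "{Inr j, w} \<in> \<gamma>"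
      using circle_realization_no_leaf[OF circle simple edge(2)] by auto
    then show "\<exists>i'. i' \<noteq> i \<and> r i' j"
      using no_Inr_Inr by (cases w) (auto simp: r_def insert_commute)
  next
    fix i
    show "\<exists>j. \<not> r i j"
    proof (rule ccontr)
      assume "\<nexists>j. \<not> r i j"
      then have "card (range (Inr :: 3 \<Rightarrow> 3 + 3)) \<le> 2"
        by (intro circle_realization_no_triod[OF circle, of _ "Inl i"]) (auto simp: r_def)
      then show False
        by (simp add: card_image)
    qed
  next
    fix j
    show "\<exists>i. \<not> r i j"
    proof (rule ccontr)
      assume "\<nexists>i. \<not> r i j"
      then have "card (range (Inl :: 3 \<Rightarrow> 3 + 3)) \<le> 2"
        by (intro circle_realization_no_triod[OF circle, of _ "Inr j"]) (auto simp: r_def insert_commute)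
      then show False
        by (simp add: card_image)
    qed
  qed
  then consider "r = (\<lambda>_ _. False)" | i j where "r = (\<lambda>x y. x \<noteq> i \<and> y \<noteq> j)"
    | c where "r = (\<lambda>x y. y \<noteq> c + 1 * x)" | c where "r = (\<lambda>x y. y \<noteq> c + 2 * x)"
    by auto
  then show ?thesis
  proof cases
    case 1
    then have "\<gamma> = {}"
      by (simp add: \<gamma> bipartite_edges_def)
    then show ?thesis ..
  next
    case 2
    then have "\<gamma> = walk_edges 4 (list_walk (square (i, j)))"
      by (simp only: \<gamma> walk_edges_square)
    then show ?thesis by blast
  next
    case 3
    then have "\<gamma> = walk_edges 6 (list_walk (hexagon (c, 1)))"
      using walk_edges_hexagon[of 1 c] \<gamma> by simp
    then show ?thesis by blast
  next
    case 4
    then have "\<gamma> = walk_edges 6 (list_walk (hexagon (c, 2)))"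
      using walk_edges_hexagon[of 2 c] \<gamma> by simp
    then show ?thesis by blast
  qed
qed

lemma walk_edges_subset_K33:
  "walk_edges 4 (list_walk (square q)) \<subseteq> K33"
  "q \<in> UNIV \<times> {1, 2} \<Longrightarrow> walk_edges 6 (list_walk (hexagon q)) \<subseteq> K33"
  using bipartite_edges_subset_K33 by (cases q; auto simp: walk_edges_square walk_edges_hexagon)+

lemma cycles_4_K33: "cycles 4 K33 = (\<lambda>q. walk_edges 4 (list_walk (square q))) ` (UNIV \<times> UNIV)"
proof (intro equalityI subsetI)
  fix \<gamma> assume "\<gamma> \<in> cycles 4 K33"
  then have \<gamma>: "\<gamma> \<subseteq> K33" "card \<gamma> = 4" "realization \<gamma> homeomorphic sphere (0::complex) 1"
    by (simp_all add: cycles_def)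
  have "\<gamma> \<noteq> walk_edges 6 (list_walk (hexagon q))" if "q \<in> UNIV \<times> {1, 2}" for q
    using card_walk_edges[OF cyclic_walk_hexagon[OF that]] \<gamma>(2) by auto
  then show "\<gamma> \<in> (\<lambda>q. walk_edges 4 (list_walk (square q))) ` (UNIV \<times> UNIV)"
    using cycle_K33_cases[OF \<gamma>(3,1)] \<gamma>(2) by fastforce
next
  fix \<gamma> assume "\<gamma> \<in> (\<lambda>q. walk_edges 4 (list_walk (square q))) ` (UNIV \<times> UNIV)"
  then obtain q where q: "\<gamma> = walk_edges 4 (list_walk (square q))"
    by blast
  show "\<gamma> \<in> cycles 4 K33"
    unfolding cycles_def q mem_Collect_eq
    by (intro conjI walk_edges_subset_K33 realization_walk_homeomorphic_circle cyclic_walk_square)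
      (simp add: card_walk_edges[OF cyclic_walk_square])
qed

lemma cycles_6_K33: "cycles 6 K33 = (\<lambda>q. walk_edges 6 (list_walk (hexagon q))) ` (UNIV \<times> {1, 2})"
proof (intro equalityI subsetI)
  fix \<gamma> assume "\<gamma> \<in> cycles 6 K33"
  then have \<gamma>: "\<gamma> \<subseteq> K33" "card \<gamma> = 6" "realization \<gamma> homeomorphic sphere (0::complex) 1"
    by (simp_all add: cycles_def)
  have "\<gamma> \<noteq> walk_edges 4 (list_walk (square q))" for q
    using card_walk_edges[OF cyclic_walk_square[of q]] \<gamma>(2) by auto
  then show "\<gamma> \<in> (\<lambda>q. walk_edges 6 (list_walk (hexagon q))) ` (UNIV \<times> {1, 2})"
    using cycle_K33_cases[OF \<gamma>(3,1)] \<gamma>(2) by fastforce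
next
  fix \<gamma> assume "\<gamma> \<in> (\<lambda>q. walk_edges 6 (list_walk (hexagon q))) ` (UNIV \<times> {1, 2})"
  then obtain q where q: "\<gamma> = walk_edges 6 (list_walk (hexagon q))" and q_in: "q \<in> UNIV \<times> {1, 2}"
    by blast
  show "\<gamma> \<in> cycles 6 K33"
    unfolding cycles_def q mem_Collect_eq
    by (intro conjI walk_edges_subset_K33 realization_walk_homeomorphic_circle cyclic_walk_hexagon q_in)
      (simp add: card_walk_edges[OF cyclic_walk_hexagon[OF q_in]])
qed

theorem corollary1p12:
  fixes f :: "real ^ (3 + 3) \<Rightarrow> complex"
    and p :: "(3 + 3) set set \<Rightarrow> real \<Rightarrow> real ^ (3 + 3)"
  assumes "plane_generic_immersion K33 f"
    and "\<And>\<gamma>. \<gamma> \<in> cycles 4 K33 \<union> cycles 6 K33 \<Longrightarrow> cycle_parametrization \<gamma> (p \<gamma>)"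
  shows "[(\<Sum>\<gamma>\<in>cycles 4 K33. rotation_number (f \<circ> p \<gamma>)) = 0] (mod 2) \<and>
         [(\<Sum>\<gamma>\<in>cycles 6 K33. rotation_number (f \<circ> p \<gamma>)) = 1] (mod 2)"
proof -
  have immersion: "continuous_on (realization K33) f" "locally_injective_on f (realization K33)"
    using assms(1) by (simp_all add: plane_generic_immersion_def)
  show ?thesis
  proof (rule rotation_number_cycle[OF immersion])
    fix n :: "3 + 3 \<Rightarrow> 3 + 3 \<Rightarrow> int" and m :: "3 + 3 \<Rightarrow> 3 + 3 \<Rightarrow> 3 + 3 \<Rightarrow> int"
    assume n: "\<And>u v. {u, v} \<in> K33 \<Longrightarrow> u \<noteq> v \<Longrightarrow> n v u = - 1 - n u v"
      and m: "\<And>u v w. {u, v} \<in> K33 \<Longrightarrow> {v, w} \<in> K33 \<Longrightarrow> u \<noteq> v \<Longrightarrow> v \<noteq> w \<Longrightarrow> u \<noteq> w \<Longrightarrow> m w v u = 1 - m u v w"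
      and rot: "\<And>k v p. cyclic_walk k v \<Longrightarrow> walk_edges k v \<subseteq> K33 \<Longrightarrow> cycle_parametrization (walk_edges k v) p \<Longrightarrow>
         [rotation_number (f \<circ> p) =
          (\<Sum>i<nat k. n (v i) (v (int i + 1)) + m (v i) (v (int i + 1)) (v (int i + 2)))] (mod 2)"
    have edge: "{Inl i, Inr j} \<in> K33" "{Inr j, Inl i} \<in> K33" for i j
      by (auto simp: K33_def insert_commute)
    have n': "n (Inr j) (Inl i) = - 1 - n (Inl i) (Inr j)" for i j
      using edge by (intro n) auto
    have m': "m (Inr j') (Inl i) (Inr j) = 1 - m (Inr j) (Inl i) (Inr j')" if "j \<noteq> j'" for i j j'
      using edge that by (intro m) auto
    have m'': "m (Inl i') (Inr j) (Inl i) = 1 - m (Inl i) (Inr j) (Inl i')" if "i \<noteq> i'" for i i' j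
      using edge that by (intro m) auto
    \<comment> \<open>Injectivity of the indexing turns the sum over cycles into a sum over index
      pairs. The walk along a list and \<open>p \<gamma>\<close> may run in opposite directions, but
      \<open>rot\<close> compares only parities.\<close>
    have "[(\<Sum>\<gamma>\<in>cycles 4 K33. rotation_number (f \<circ> p \<gamma>)) =
        (\<Sum>q\<in>UNIV \<times> UNIV. \<Sum>i<nat 4. let v = list_walk (square q) in
          n (v i) (v (int i + 1)) + m (v i) (v (int i + 1)) (v (int i + 2)))] (mod 2)"
      unfolding cycles_4_K33 sum.reindex[OF inj_on_subset[OF inj_square subset_UNIV]] o_def[of "\<lambda>\<gamma>. rotation_number (f \<circ> p \<gamma>)"] Let_def
      by (intro cong_sum rot cyclic_walk_square walk_edges_subset_K33 assms(2)) (simp add: cycles_4_K33)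
    moreover have "[(\<Sum>\<gamma>\<in>cycles 6 K33. rotation_number (f \<circ> p \<gamma>)) =
        (\<Sum>q\<in>UNIV \<times> {1, 2}. \<Sum>i<nat 6. let v = list_walk (hexagon q) in
          n (v i) (v (int i + 1)) + m (v i) (v (int i + 1)) (v (int i + 2)))] (mod 2)"
      unfolding cycles_6_K33 sum.reindex[OF inj_hexagon] o_def[of "\<lambda>\<gamma>. rotation_number (f \<circ> p \<gamma>)"] Let_def
      by (intro cong_sum rot cyclic_walk_hexagon walk_edges_subset_K33 assms(2)) (auto simp: cycles_6_K33)
    ultimately show ?thesis
      using sum_squares_even[of n m, OF n' m' m''] sum_hexagons_odd[of n m, OF n' m' m''] cong_trans by blast
  qed
qed

end
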